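(* Let $A\in\mathscr{D}\mathrm{iag}$ with $L(A)>0$ and fix an integer $p\in\mathbb{N}$. There are constants $\delta=\delta(A)>0$ and $\bar n=\bar n(A)\in\mathbb{N}$ such that if $B\in\mathrm{SL}_2(\mathbb{R})^k$ is any cocycle with $d(B,A)\le\delta$, then $$\mathbb{P}\Big[\Big|\tfrac1n\log\|B^{(n)}\|-L_n(B)\Big|>n^{-1/5}\Big]\le e^{-n^{\frac1{20p}}}$$ for all scales $n$ with $\bar n\le n\le\big(\log d(B,\mathscr{D}\mathrm{iag})^{-1}\big)^p$.
   Context: $\mathrm{SL}_2(\mathbb{R})$ denotes real $2\times2$ matrices with determinant $\pm1$. $\Sigma=\{1,\dots,k\}$, a probability vector $(p_1,\dots,p_k)$ with positive entries, $X=\Sigma^{\mathbb{Z}}$ with the product probability $\mathbb{P}$ and expectation $\mathbb{E}$; a cocycle $B=(B_1,\dots,B_k)$ has iterates $B^{(n)}(x)=B_{x_{n-1}}\cdots B_{x_0}$ and Lyapunov exponent $L(B)$; $d(A,B)=\max_j\|A_j-B_j\|$. $\mathscr{D}\mathrm{iag}$ is the set of cocycles with two transversal lines invariant under all matrices, $d(B,\mathscr{D}\mathrm{iag})=\inf_{D\in\mathscr{D}\mathrm{iag}}d(B,D)$ (if it is $0$, the upper bound on $n$ is $+\infty$). The finite scale Lyapunov exponent is $L_n(B)=\mathbb{E}[\frac1n\log\|B^{(n)}\|]$. *)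

theory Defs
  imports "HOL-Probability.Probability"
begin

type_synonym mat2 = "real^2^2"

definition mnorm :: "mat2 \<Rightarrow> real" where
  "mnorm M = onorm (\<lambda>v. M *v v)"

text \<open>A cocycle over the alphabet {1..k} is a function B :: nat => mat2 (only B 1..B k matter).\<close>
definition SL2_cocycle :: "nat \<Rightarrow> (nat \<Rightarrow> mat2) \<Rightarrow> bool" where
  "SL2_cocycle k B \<longleftrightarrow> (\<forall>j\<in>{1..k}. det (B j) = 1 \<or> det (B j) = -1)"

definition dist_coc :: "nat \<Rightarrow> (nat \<Rightarrow> mat2) \<Rightarrow> (nat \<Rightarrow> mat2) \<Rightarrow> real" where
  "dist_coc k A B = Max ((\<lambda>j. mnorm (A j - B j)) ` {1..k})"

definition Diag :: "nat \<Rightarrow> (nat \<Rightarrow> mat2) \<Rightarrow> bool" where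
  "Diag k D \<longleftrightarrow> SL2_cocycle k D \<and>
     (\<exists>u v :: real^2. u \<noteq> 0 \<and> v \<noteq> 0 \<and> span {u} \<noteq> span {v} \<and>
        (\<forall>j\<in>{1..k}. (\<lambda>w. D j *v w) ` span {u} \<subseteq> span {u} \<and>
                     (\<lambda>w. D j *v w) ` span {v} \<subseteq> span {v}))"

definition dist_Diag :: "nat \<Rightarrow> (nat \<Rightarrow> mat2) \<Rightarrow> real" where
  "dist_Diag k B = Inf ((dist_coc k B) ` {D. Diag k D})"

fun itr :: "(nat \<Rightarrow> mat2) \<Rightarrow> (int \<Rightarrow> nat) \<Rightarrow> nat \<Rightarrow> mat2" where
  "itr B x 0 = mat 1"
| "itr B x (Suc n) = B (x (int n)) ** itr B x n"

definition Xmeas :: "nat pmf \<Rightarrow> (int \<Rightarrow> nat) measure" where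
  "Xmeas P = PiM (UNIV :: int set) (\<lambda>_. measure_pmf P)"

definition Ln :: "nat pmf \<Rightarrow> (nat \<Rightarrow> mat2) \<Rightarrow> nat \<Rightarrow> real" where
  "Ln P B n = (\<integral>x. ln (mnorm (itr B x n)) / real n \<partial>Xmeas P)"

definition Lyap :: "nat pmf \<Rightarrow> (nat \<Rightarrow> mat2) \<Rightarrow> real" where
  "Lyap P B = lim (\<lambda>n. Ln P B n)"

end

theory Submission
  imports Defs "HOL-Real_Asymp.Real_Asymp"
begin

text \<open>
  On the admissible scales \<open>B\<close> is within \<open>2 * exp (- n powr (1 / p))\<close> of some diagonalizable \<open>D\<close>. Along
  the expanding eigenline of \<open>D\<close>, the logarithm of the growth of the product is a sum \<open>S\<close> of bounded
  i.i.d. variables with positive mean. Hoeffding's inequality shows that, outside a set of probability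
  \<open>exp (- c * h)\<close> up to a polynomial factor, no partial sum of \<open>S\<close> over a segment falls below \<open>- h\<close>,
  where \<open>h = n powr (1 / (2 * p))\<close>. On that event the error of replacing \<open>D\<close> by \<open>B\<close>, telescoped over
  the \<open>n\<close> factors, is negligible against \<open>exp S\<close>, so that the log-norm of the product of \<open>B\<close> is \<open>S\<close> up to
  \<open>O(h)\<close>; another application of Hoeffding's inequality controls \<open>S\<close>. All constants are uniform in \<open>D\<close>:
  the angle between the eigenlines is bounded below by the spectral gap of one hyperbolic letter of \<open>A\<close>,
  and the mean by comparing the finite scale exponents of \<open>D\<close> and \<open>A\<close> at one fixed scale.
\<close>

section \<open>Two-dimensional linear algebra\<close>

lemma mnorm_apply: "norm (M *v w) \<le> mnorm M * norm w"
  unfolding mnorm_def by (rule onorm) (rule matrix_vector_mul_bounded_linear)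

lemma mnorm_nonneg: "0 \<le> mnorm M"
  unfolding mnorm_def by (rule onorm_pos_le) (rule matrix_vector_mul_bounded_linear)

lemma mnorm_leI: "(\<And>w. norm (M *v w) \<le> c * norm w) \<Longrightarrow> mnorm M \<le> c"
  unfolding mnorm_def by (rule onorm_le)

lemma mnorm_mult_le: "mnorm (M ** N) \<le> mnorm M * mnorm N"
proof (rule mnorm_leI)
  fix w
  have "norm ((M ** N) *v w) \<le> mnorm M * norm (N *v w)"
    using mnorm_apply[of M "N *v w"] by (simp add: matrix_vector_mul_assoc)
  also have "\<dots> \<le> mnorm M * (mnorm N * norm w)"
    by (intro mult_left_mono mnorm_apply mnorm_nonneg)
  finally show "norm ((M ** N) *v w) \<le> mnorm M * mnorm N * norm w" by (simp add: mult.assoc)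
qed

lemma mnorm_triangle: "mnorm (M + N) \<le> mnorm M + mnorm N"
proof (rule mnorm_leI)
  fix w
  have "norm ((M + N) *v w) \<le> norm (M *v w) + norm (N *v w)"
    by (simp add: matrix_vector_mult_add_rdistrib norm_triangle_ineq)
  also have "\<dots> \<le> mnorm M * norm w + mnorm N * norm w" by (intro add_mono mnorm_apply)
  finally show "norm ((M + N) *v w) \<le> (mnorm M + mnorm N) * norm w" by (simp add: algebra_simps)
qed

lemma mnorm_zero: "mnorm 0 = 0"
  by (rule order_antisym[OF mnorm_leI mnorm_nonneg]) simp

lemma mnorm_minus_commute: "mnorm (M - N) = mnorm (N - M)"
proof -
  have "mnorm (M - N) \<le> mnorm (N - M)" for M N :: mat2
    using mnorm_apply[of "N - M"]
    by (intro mnorm_leI) (metis matrix_vector_mult_diff_rdistrib norm_minus_commute)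
  then show ?thesis by (meson order_antisym)
qed

lemma mnorm_sum_le: "mnorm (sum F I) \<le> (\<Sum>i\<in>I. mnorm (F i))"
proof (induction I rule: infinite_finite_induct)
  case (insert i I)
  then show ?case using mnorm_triangle[of "F i" "sum F I"] by simp
qed (simp_all add: mnorm_zero)

lemma mnorm_mat1: "mnorm (mat 1) = 1"
  by (simp add: mnorm_def onorm_id)

text \<open>Bridge from the operator norm to the metric on matrices, in which continuity of
  \<open>disc2\<close> is expressed. Each of the four entries is at most \<open>mnorm M\<close> in
  absolute value.\<close>

lemma norm_le_mnorm: "norm (M :: mat2) \<le> 4 * mnorm M"
proof -
  have e: "\<bar>M $ i $ j\<bar> \<le> mnorm M" for i j
    unfolding mnorm_def by (rule matrix_component_le_onorm)
  have "norm (M $ i) \<le> 2 * mnorm M" for i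
    using norm_le_l1_cart[of "M $ i"] e[of i 1] e[of i 2] by (simp add: sum_2)
  moreover have "norm M \<le> (\<Sum>i\<in>UNIV. norm (M $ i))"
    unfolding norm_vec_def[of M] by (rule L2_set_le_sum) simp
  ultimately show ?thesis
    by (smt (verit, best) sum_2)
qed

section \<open>Signed area and transversality\<close>

text \<open>The determinant with columns \<open>u\<close> and \<open>v\<close>. For unit vectors its
  absolute value is the sine of the angle between the two lines, hence a quantitative measure of
  transversality.\<close>

definition cross2 :: "real^2 \<Rightarrow> real^2 \<Rightarrow> real" where
  "cross2 u v = u $ 1 * v $ 2 - u $ 2 * v $ 1"

lemma norm_sq_2: "(norm (u :: real^2))\<^sup>2 = (u $ 1)\<^sup>2 + (u $ 2)\<^sup>2"
  unfolding power2_norm_eq_inner inner_vec_def sum_2 by (simp add: power2_eq_square)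

text \<open>Lagrange's identity in the plane.\<close>

lemma cross2_sq: "(cross2 u v)\<^sup>2 + (u \<bullet> v)\<^sup>2 = (norm u)\<^sup>2 * (norm v)\<^sup>2"
  unfolding norm_sq_2 cross2_def inner_vec_def sum_2 by (simp add: power2_eq_square algebra_simps)

lemma cross2_le: "\<bar>cross2 u v\<bar> \<le> norm u * norm v"
proof -
  have "(cross2 u v)\<^sup>2 \<le> (norm u * norm v)\<^sup>2"
    using cross2_sq[of u v] by (simp add: power_mult_distrib) (metis le_add_same_cancel1 zero_le_power2)
  then show ?thesis by (metis abs_le_square_iff abs_mult abs_norm_cancel)
qed

lemma cross2_matrix: "cross2 (M *v u) (M *v v) = det M * cross2 u v"
  unfolding cross2_def det_2 matrix_vector_mult_def by (simp add: sum_2 algebra_simps)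

lemma cross2_scaleR: "cross2 (c *\<^sub>R u) (d *\<^sub>R v) = c * d * cross2 u v"
  unfolding cross2_def by (simp add: algebra_simps)

text \<open>Cramer's rule for the coordinates of \<open>w\<close> in the basis \<open>u\<close>,
  \<open>v\<close>, with the denominator cleared.\<close>

lemma cross2_expand: "cross2 u v *\<^sub>R w = cross2 w v *\<^sub>R u + cross2 u w *\<^sub>R v"
  unfolding cross2_def vec_eq_iff forall_2 by (simp add: algebra_simps)

text \<open>The unit square is mapped to a parallelogram of area 1, and an area is at most the
  product of the side lengths. This makes all logarithms of norms of iterates nonnegative.\<close>

lemma mnorm_ge_1:
  assumes "\<bar>det M\<bar> = 1"
  shows "1 \<le> mnorm M"
proof -
  have c: "cross2 (axis 1 1) (axis 2 1) = 1" by (simp add: cross2_def axis_def)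
  have "1 = \<bar>cross2 (M *v axis 1 1) (M *v axis 2 1)\<bar>"
    using assms by (simp add: cross2_matrix c)
  also have "\<dots> \<le> norm (M *v axis 1 1) * norm (M *v axis 2 1)" by (rule cross2_le)
  also have "\<dots> \<le> mnorm M * mnorm M"
    using mnorm_apply[of M "axis 1 1"] mnorm_apply[of M "axis 2 1"]
    by (intro mult_mono) (simp_all add: mnorm_nonneg)
  finally show ?thesis
    by (metis abs_of_nonneg abs_le_square_iff abs_one mnorm_nonneg power2_eq_square one_power2)
qed

lemma cross2_eq_0_imp_span_eq:
  assumes "u \<noteq> 0" "v \<noteq> 0" "cross2 u v = 0"
  shows "span {u} = span {v}"
proof -
  have sub: "span {u} \<subseteq> span {v}" if uv: "u \<noteq> 0" "v \<noteq> 0" "cross2 u v = 0" for u v :: "real^2"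
  proof -
    have "\<exists>c. u = c *\<^sub>R v"
    proof (cases "v $ 1 = 0")
      case True
      then have "v $ 2 \<noteq> 0" using uv(2) by (auto simp: vec_eq_iff forall_2)
      then have "u = (u $ 2 / v $ 2) *\<^sub>R v" using uv(3) True
        by (auto simp: vec_eq_iff forall_2 cross2_def)
      then show ?thesis by blast
    next
      case False
      then have "u = (u $ 1 / v $ 1) *\<^sub>R v" using uv(3)
        by (auto simp: vec_eq_iff forall_2 cross2_def field_simps)
      then show ?thesis by blast
    qed
    then have "u \<in> span {v}" by (auto simp: span_singleton)
    then show ?thesis by (simp add: span_minimal)
  qed
  have "cross2 v u = 0" using assms(3) by (simp add: cross2_def algebra_simps)
  then show ?thesis using sub assms by (meson subset_antisym)
qed

section \<open>Diagonal cocycles in eigencoordinates\<close>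

text \<open>A diagonal cocycle seen through unit eigenvectors. The condition on
  \<open>a j * b j\<close> is the determinant condition; the roles of \<open>u\<close> and
  \<open>v\<close> are symmetric, so either line may later be taken as the expanding one.\<close>

definition eigenframe ::
  "nat \<Rightarrow> (nat \<Rightarrow> mat2) \<Rightarrow> real^2 \<Rightarrow> real^2 \<Rightarrow> (nat \<Rightarrow> real) \<Rightarrow> (nat \<Rightarrow> real) \<Rightarrow> bool" where
  "eigenframe k D u v a b \<longleftrightarrow> norm u = 1 \<and> norm v = 1 \<and> cross2 u v \<noteq> 0 \<and>
     (\<forall>j\<in>{1..k}. D j *v u = a j *\<^sub>R u \<and> D j *v v = b j *\<^sub>R v \<and> \<bar>a j * b j\<bar> = 1)"

lemma eigenframe_swap: "eigenframe k D u v a b \<Longrightarrow> eigenframe k D v u b a"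
  unfolding eigenframe_def cross2_def mult.commute[of "u $ _"] mult.commute[of "b _"]
  by simp

text \<open>An invariant line is spanned by an eigenvector; comparing areas identifies the
  determinant with the product of the two eigenvalues.\<close>

lemma Diag_eigenframe:
  assumes "Diag k D"
  obtains u v a b where "eigenframe k D u v a b"
proof -
  obtain u v where uv: "u \<noteq> 0" "v \<noteq> 0" "span {u} \<noteq> span {v}"
    and inv: "\<forall>j\<in>{1..k}. (\<lambda>w. D j *v w) ` span {u} \<subseteq> span {u} \<and> (\<lambda>w. D j *v w) ` span {v} \<subseteq> span {v}"
    using assms unfolding Diag_def by (elim conjE exE) (rule that)
  have det: "\<bar>det (D j)\<bar> = 1" if "j \<in> {1..k}" for j
    using assms that unfolding Diag_def SL2_cocycle_def by fastforce
  have ev: "\<exists>c. M *v (w /\<^sub>R norm w) = c *\<^sub>R (w /\<^sub>R norm w)"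
    if "(\<lambda>w. M *v w) ` span {w} \<subseteq> span {w}" "w \<noteq> 0" for M :: mat2 and w
  proof -
    have "M *v w \<in> span {w}" using that(1) span_base[of w "{w}"] by blast
    then obtain c where "M *v w = c *\<^sub>R w" by (auto simp: span_singleton)
    then have "M *v (w /\<^sub>R norm w) = c *\<^sub>R (w /\<^sub>R norm w)"
      by (simp add: matrix_vector_mult_scaleR)
    then show ?thesis by blast
  qed
  define u' v' where "u' = u /\<^sub>R norm u" and "v' = v /\<^sub>R norm v"
  have "\<forall>j\<in>{1..k}. \<exists>c. D j *v u' = c *\<^sub>R u'"
    unfolding u'_def using inv uv(1) by (intro ballI ev) simp_all
  from bchoice[OF this] obtain a where a: "\<And>j. j \<in> {1..k} \<Longrightarrow> D j *v u' = a j *\<^sub>R u'" by blast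
  have "\<forall>j\<in>{1..k}. \<exists>c. D j *v v' = c *\<^sub>R v'"
    unfolding v'_def using inv uv(2) by (intro ballI ev) simp_all
  from bchoice[OF this] obtain b where b: "\<And>j. j \<in> {1..k} \<Longrightarrow> D j *v v' = b j *\<^sub>R v'" by blast
  have c: "cross2 u' v' \<noteq> 0"
    using cross2_eq_0_imp_span_eq[OF uv(1,2)] uv unfolding u'_def v'_def by (auto simp: cross2_scaleR)
  have "\<bar>a j * b j\<bar> = 1" if j: "j \<in> {1..k}" for j
  proof -
    have "a j * b j * cross2 u' v' = det (D j) * cross2 u' v'"
      using cross2_matrix[of "D j" u' v'] a[OF j] b[OF j] by (simp add: cross2_scaleR)
    then show ?thesis using c det[OF j] by simp
  qed
  moreover have "norm u' = 1" "norm v' = 1" using uv by (simp_all add: u'_def v'_def)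
  ultimately have "eigenframe k D u' v' a b" unfolding eigenframe_def using a b c by blast
  then show thesis by (rule that)
qed

section \<open>Iterates and their perturbation\<close>

lemma det_itr:
  assumes "SL2_cocycle k B" "\<And>i. x i \<in> {1..k}"
  shows "\<bar>det (itr B x n)\<bar> = 1"
proof (induction n)
  case (Suc n)
  have "\<bar>det (B (x (int n)))\<bar> = 1"
    using assms(1) assms(2)[of "int n"] unfolding SL2_cocycle_def by fastforce
  then show ?case using Suc by (simp add: det_mul abs_mult)
qed simp

lemma mnorm_itr_ge_1:
  assumes "SL2_cocycle k B" "\<And>i. x i \<in> {1..k}"
  shows "1 \<le> mnorm (itr B x n)"
  by (rule mnorm_ge_1[OF det_itr[OF assms]])

lemma mnorm_itr_le:
  assumes "\<And>j. j \<in> {1..k} \<Longrightarrow> mnorm (B j) \<le> R" "\<And>i. x i \<in> {1..k}" "0 \<le> R"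
  shows "mnorm (itr B x n) \<le> R ^ n"
proof (induction n)
  case (Suc n)
  have "mnorm (itr B x (Suc n)) \<le> mnorm (B (x (int n))) * mnorm (itr B x n)"
    by (simp add: mnorm_mult_le)
  also have "\<dots> \<le> R * R ^ n" using assms Suc by (intro mult_mono) (auto simp: mnorm_nonneg)
  finally show ?case by simp
qed (simp add: mnorm_mat1)

lemma matrix_mult_diff_left: "(M :: mat2) ** (N - N') = M ** N - M ** N'"
  by (simp add: vec_eq_iff matrix_matrix_mult_def sum_subtractf right_diff_distrib)

lemma matrix_mult_diff_right: "((M :: mat2) - M') ** N = M ** N - M' ** N"
  by (simp add: vec_eq_iff matrix_matrix_mult_def sum_subtractf left_diff_distrib)

lemma matrix_mult_sum_left: "(M :: mat2) ** (\<Sum>i\<in>I. N i) = (\<Sum>i\<in>I. M ** N i)"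
  by (induction I rule: infinite_finite_induct) (simp_all add: matrix_add_ldistrib)

text \<open>Letters are replaced one at a time: summand \<open>i\<close> has the factors of
  \<open>B\<close> before time \<open>i\<close>, the error at time \<open>i\<close>, and the factors
  of \<open>D\<close> after it. The tail is an iterate over the sequence shifted by
  \<open>Suc i\<close>.\<close>

lemma itr_diff_telescope:
  "itr B x n - itr D x n =
    (\<Sum>i<n. itr D (\<lambda>t. x (t + int (Suc i))) (n - Suc i) ** ((B (x (int i)) - D (x (int i))) ** itr B x i))"
proof (induction n)
  case (Suc n)
  have seg: "D (x (int n)) ** itr D (\<lambda>t. x (t + int (Suc i))) (n - Suc i)
      = itr D (\<lambda>t. x (t + int (Suc i))) (Suc n - Suc i)" if "i < n" for i
  proof -
    have "Suc n - Suc i = Suc (n - Suc i)" "int (n - Suc i) + int (Suc i) = int n" using that by auto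
    then show ?thesis by simp
  qed
  have "itr B x (Suc n) - itr D x (Suc n) =
      (B (x (int n)) - D (x (int n))) ** itr B x n + D (x (int n)) ** (itr B x n - itr D x n)"
    by (simp add: matrix_mult_diff_left matrix_mult_diff_right)
  also have "D (x (int n)) ** (itr B x n - itr D x n) =
     (\<Sum>i<n. itr D (\<lambda>t. x (t + int (Suc i))) (Suc n - Suc i) ** ((B (x (int i)) - D (x (int i))) ** itr B x i))"
    unfolding Suc.IH matrix_mult_sum_left
    by (intro sum.cong refl) (use seg in \<open>simp only: matrix_mul_assoc lessThan_iff\<close>)
  finally show ?case by (simp add: add.commute)
qed simp

section \<open>Products of nearly diagonal cocycles\<close>

lemma itr_eigenvector:
  assumes "\<And>j. j \<in> {1..k} \<Longrightarrow> D j *v u = a j *\<^sub>R u" "\<And>i. x i \<in> {1..k}"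
  shows "itr D x n *v u = (\<Prod>t<n. a (x (int t))) *\<^sub>R u"
  by (induction n)
    (simp_all add: assms(1)[OF assms(2)] matrix_vector_mult_scaleR mult.commute flip: matrix_vector_mul_assoc)

lemma abs_prod_eq_exp_sum:
  fixes n :: nat
  assumes "\<And>t. t < n \<Longrightarrow> c t \<noteq> 0"
  shows "\<bar>\<Prod>t<n. c t\<bar> = exp (\<Sum>t<n. ln \<bar>c t\<bar> :: real)"
proof -
  have "exp (\<Sum>t<n. ln \<bar>c t\<bar>) = (\<Prod>t<n. \<bar>c t\<bar>)"
    using assms by (subst exp_sum) (auto intro!: prod.cong)
  then show ?thesis by (simp add: abs_prod)
qed

lemma eigenvalue_le_mnorm:
  assumes "M *v u = c *\<^sub>R u" "norm u = 1"
  shows "\<bar>c\<bar> \<le> mnorm M"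
  using mnorm_apply[of M u] assms by simp

lemma eigenframe_nonzero:
  assumes "eigenframe k D u v a b" "j \<in> {1..k}"
  shows "a j \<noteq> 0" "b j \<noteq> 0" "ln \<bar>b j\<bar> = - ln \<bar>a j\<bar>"
proof -
  have ab: "\<bar>a j * b j\<bar> = 1" using assms unfolding eigenframe_def by blast
  then show nz: "a j \<noteq> 0" "b j \<noteq> 0" by auto
  have "ln \<bar>a j\<bar> + ln \<bar>b j\<bar> = ln \<bar>a j * b j\<bar>" using nz by (simp add: abs_mult ln_mult)
  then show "ln \<bar>b j\<bar> = - ln \<bar>a j\<bar>" using ab by simp
qed

text \<open>The norm bounds both eigenvalues from above; as their product has modulus 1, the bound
  on \<open>b j\<close> is a lower bound on \<open>a j\<close>.\<close>

lemma eigenframe_ln_bound: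
  assumes "eigenframe k D u v a b" "j \<in> {1..k}" "mnorm (D j) \<le> R" "0 < R"
  shows "\<bar>ln \<bar>a j\<bar>\<bar> \<le> ln R"
proof -
  have ev: "D j *v u = a j *\<^sub>R u" "D j *v v = b j *\<^sub>R v" "norm u = 1" "norm v = 1"
    using assms(1,2) unfolding eigenframe_def by blast+
  note nz = eigenframe_nonzero[OF assms(1,2)]
  have "\<bar>a j\<bar> \<le> R" "\<bar>b j\<bar> \<le> R"
    using eigenvalue_le_mnorm[OF ev(1,3)] eigenvalue_le_mnorm[OF ev(2,4)] assms(3) by linarith+
  then have "ln \<bar>a j\<bar> \<le> ln R" "ln \<bar>b j\<bar> \<le> ln R" using nz assms(4) by (subst ln_le_cancel_iff; simp)+
  then show ?thesis using nz(3) by linarith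
qed

text \<open>The eigenvalues of the product have moduli \<open>exp S\<close> and
  \<open>exp (- S)\<close>, whence the lower bound. For the upper bound a vector is expanded by
  Cramer's rule: two terms, each with a coefficient of size at most
  \<open>norm w / \<kappa>\<close>.\<close>

lemma mnorm_itr_eigenframe:
  fixes n :: nat
  assumes fr: "eigenframe k D u v a b" and x: "\<And>i. x i \<in> {1..k}"
    and kap: "0 < \<kappa>" "\<kappa> \<le> \<bar>cross2 u v\<bar>"
  defines "S \<equiv> \<Sum>t<n. ln \<bar>a (x (int t))\<bar>"
  shows "exp \<bar>S\<bar> \<le> mnorm (itr D x n)" "mnorm (itr D x n) \<le> 2 / \<kappa> * exp \<bar>S\<bar>"
proof -
  have ev: "\<And>j. j \<in> {1..k} \<Longrightarrow> D j *v u = a j *\<^sub>R u" "\<And>j. j \<in> {1..k} \<Longrightarrow> D j *v v = b j *\<^sub>R v"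
    and nrm: "norm u = 1" "norm v = 1"
    using fr unfolding eigenframe_def by blast+
  define p q where "p = (\<Prod>t<n. a (x (int t)))" and "q = (\<Prod>t<n. b (x (int t)))"
  have pu: "itr D x n *v u = p *\<^sub>R u" unfolding p_def by (rule itr_eigenvector[OF ev(1) x])
  have qv: "itr D x n *v v = q *\<^sub>R v" unfolding q_def by (rule itr_eigenvector[OF ev(2) x])
  have p: "\<bar>p\<bar> = exp S" unfolding p_def S_def
    using eigenframe_nonzero(1)[OF fr x] by (rule abs_prod_eq_exp_sum)
  have "\<bar>q\<bar> = exp (\<Sum>t<n. ln \<bar>b (x (int t))\<bar>)" unfolding q_def
    using eigenframe_nonzero(2)[OF fr x] by (rule abs_prod_eq_exp_sum)
  then have q: "\<bar>q\<bar> = exp (- S)"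
    unfolding S_def using eigenframe_nonzero(3)[OF fr x] by (simp add: sum_negf)
  show "exp \<bar>S\<bar> \<le> mnorm (itr D x n)"
    using eigenvalue_le_mnorm[OF pu nrm(1)] eigenvalue_le_mnorm[OF qv nrm(2)] p q
    by (cases "S \<ge> 0") simp_all
  show "mnorm (itr D x n) \<le> 2 / \<kappa> * exp \<bar>S\<bar>"
  proof (rule mnorm_leI)
    fix w
    let ?c = "cross2 u v"
    have "?c *\<^sub>R (itr D x n *v w) = itr D x n *v (?c *\<^sub>R w)" by (simp add: matrix_vector_mult_scaleR)
    also have "\<dots> = (cross2 w v * p) *\<^sub>R u + (cross2 u w * q) *\<^sub>R v"
      unfolding cross2_expand[of u v w]
      by (simp add: matrix_vector_right_distrib matrix_vector_mult_scaleR pu qv)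
    finally have "\<bar>?c\<bar> * norm (itr D x n *v w) \<le> \<bar>cross2 w v\<bar> * \<bar>p\<bar> + \<bar>cross2 u w\<bar> * \<bar>q\<bar>"
      using norm_triangle_ineq[of "(cross2 w v * p) *\<^sub>R u" "(cross2 u w * q) *\<^sub>R v"] nrm
      by (metis abs_mult mult.right_neutral norm_scaleR)
    also have "\<dots> \<le> norm w * exp \<bar>S\<bar> + norm w * exp \<bar>S\<bar>"
      using cross2_le[of w v] cross2_le[of u w] nrm unfolding p q
      by (intro add_mono mult_mono) auto
    finally have "\<bar>?c\<bar> * norm (itr D x n *v w) \<le> 2 * exp \<bar>S\<bar> * norm w" by (simp add: mult_ac)
    moreover have "\<kappa> * norm (itr D x n *v w) \<le> \<bar>?c\<bar> * norm (itr D x n *v w)"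
      using kap by (intro mult_right_mono) auto
    ultimately have "\<kappa> * norm (itr D x n *v w) \<le> 2 * exp \<bar>S\<bar> * norm w" by linarith
    then show "norm (itr D x n *v w) \<le> 2 / \<kappa> * exp \<bar>S\<bar> * norm w"
      using kap by (simp add: field_simps)
  qed
qed

section \<open>Shadowing of a diagonal product\<close>

lemma sum_lessThan_shift:
  fixes g :: "nat \<Rightarrow> real"
  shows "(\<Sum>t<q. g (t + m)) = (\<Sum>t<m + q. g t) - (\<Sum>t<m. g t)"
  by (induction q) (simp_all add: add.commute)

text \<open>
  If the log-eigenvalue sums never drop by more than \<open>h\<close>, every segment of the diagonal product is
  expanded along \<open>u\<close> up to a factor \<open>exp (2 * h)\<close>. The telescoped error of replacing \<open>D\<close> by \<open>B\<close> is
  then smaller than the growth along \<open>u\<close> itself.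
\<close>

lemma mnorm_itr_shadowing:
  assumes fr: "eigenframe k D u v a b" and x: "\<And>i. x i \<in> {1..k}"
    and kap: "0 < \<kappa>" "\<kappa> \<le> \<bar>cross2 u v\<bar>"
    and R: "\<And>j. j \<in> {1..k} \<Longrightarrow> \<bar>ln \<bar>a j\<bar>\<bar> \<le> ln R" "0 < R"
    and eps: "\<And>j. j \<in> {1..k} \<Longrightarrow> mnorm (B j - D j) \<le> \<epsilon>" "0 \<le> \<epsilon>"
    and h: "0 \<le> h" and drop: "\<And>m q. m + q \<le> n \<Longrightarrow> - h \<le> (\<Sum>t<q. ln \<bar>a (x (int (t + m)))\<bar>)"
    and small: "4 * real n * (2 / \<kappa>)\<^sup>2 * R * \<epsilon> * exp (4 * h) \<le> 1"
  defines "S \<equiv> \<lambda>i. \<Sum>t<i. ln \<bar>a (x (int t))\<bar>"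
  shows "exp (S n) / 2 \<le> mnorm (itr B x n)" "mnorm (itr B x n) \<le> 4 / \<kappa> * exp (S n + 2 * h)"
proof -
  define K where "K = 2 / \<kappa>"
  have "\<kappa> \<le> 1" using kap cross2_le[of u v] fr unfolding eigenframe_def by auto
  then have K: "1 \<le> K" using kap by (simp add: K_def)
  have segsum: "(\<Sum>t<q. ln \<bar>a (x (int t + int m))\<bar>) = S (m + q) - S m" for m q
    using sum_lessThan_shift[of "\<lambda>t. ln \<bar>a (x (int t))\<bar>" m q] by (simp add: S_def)
  have drop': "- h \<le> S j - S i" if "i \<le> j" "j \<le> n" for i j
    using drop[of i "j - i"] segsum[where m = i and q = "j - i"] that by simp
  have seg: "mnorm (itr D (\<lambda>t. x (t + int m)) q) \<le> K * exp (S (m + q) - S m + 2 * h)"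
    if "m + q \<le> n" for m q
  proof -
    have "mnorm (itr D (\<lambda>t. x (t + int m)) q) \<le> K * exp \<bar>S (m + q) - S m\<bar>"
      using mnorm_itr_eigenframe(2)[OF fr, of "\<lambda>t. x (t + int m)" \<kappa> q] x kap
      unfolding segsum K_def by blast
    \<comment> \<open>A number \<open>s\<close> with \<open>s \<ge> - h\<close> satisfies
      \<open>\<bar>s\<bar> \<le> s + 2 * h\<close>.\<close>
    also have "\<dots> \<le> K * exp (S (m + q) - S m + 2 * h)"
      using K drop'[of m "m + q"] that h by (intro mult_left_mono) (auto simp: abs_if)
    finally show ?thesis .
  qed
  have S0: "S 0 = 0" by (simp add: S_def)
  \<comment> \<open>The two bounds feed each other: the norm bounds at earlier times control the
    telescoped error at time \<open>i\<close>, and that error gives the norm bound at time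
    \<open>i\<close>.\<close>
  have main: "mnorm (itr B x i) \<le> 2 * K * exp (S i + 2 * h) \<and> mnorm (itr B x i - itr D x i) \<le> exp (S i) / 2"
    if "i \<le> n" for i
    using that
  proof (induction i rule: less_induct)
    case (less i)
    have step: "mnorm (itr D (\<lambda>t. x (t + int (Suc l))) (i - Suc l) ** ((B (x (int l)) - D (x (int l))) ** itr B x l))
        \<le> 2 * K\<^sup>2 * R * \<epsilon> * exp (4 * h) * exp (S i)" (is "mnorm (?X ** (?Y ** ?Z)) \<le> _") if l: "l < i" for l
    proof -
      have "S (Suc l) = S l + ln \<bar>a (x (int l))\<bar>" by (simp add: S_def)
      then have SS: "S l - S (Suc l) \<le> ln R" using R(1)[OF x[of "int l"]] by linarith
      have eX: "mnorm ?X \<le> K * exp (S i - S (Suc l) + 2 * h)"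
        using seg[of "Suc l" "i - Suc l"] l less.prems by simp
      have "mnorm (?X ** (?Y ** ?Z)) \<le> mnorm ?X * (mnorm ?Y * mnorm ?Z)"
        by (rule order_trans[OF mnorm_mult_le]) (intro mult_left_mono mnorm_mult_le mnorm_nonneg)
      also have "\<dots> \<le> (K * exp (S i - S (Suc l) + 2 * h)) * (\<epsilon> * (2 * K * exp (S l + 2 * h)))"
        using less.IH[OF l] less.prems l eps(1)[OF x] eX eps(2) K
        by (intro mult_mono) (auto simp: mnorm_nonneg intro!: mult_nonneg_nonneg)
      \<comment> \<open>The growth before and after time \<open>l\<close> recombines to
        \<open>exp (S i)\<close>, except for the one letter at time \<open>l\<close>, which costs at
        most a factor \<open>R\<close>.\<close>
      also have "\<dots> = 2 * K\<^sup>2 * \<epsilon> * exp (S i + (S l - S (Suc l)) + 4 * h)"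
        by (simp add: power2_eq_square exp_add exp_diff field_simps flip: exp_add)
      also have "\<dots> \<le> 2 * K\<^sup>2 * \<epsilon> * exp (S i + ln R + 4 * h)"
        using SS eps(2) by (intro mult_left_mono) auto
      also have "\<dots> = 2 * K\<^sup>2 * R * \<epsilon> * exp (4 * h) * exp (S i)"
        using R(2) by (simp add: exp_add)
      finally show ?thesis .
    qed
    have "mnorm (itr B x i - itr D x i) \<le> (\<Sum>l<i. 2 * K\<^sup>2 * R * \<epsilon> * exp (4 * h) * exp (S i))"
      unfolding itr_diff_telescope by (rule order_trans[OF mnorm_sum_le]) (intro sum_mono step, simp)
    also have "\<dots> = real i * (2 * K\<^sup>2 * R * \<epsilon> * exp (4 * h) * exp (S i))" by simp
    also have "\<dots> \<le> real n * (2 * K\<^sup>2 * R * \<epsilon> * exp (4 * h) * exp (S i))"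
      using less.prems R(2) eps(2) by (intro mult_right_mono) auto
    also have "\<dots> = (4 * real n * K\<^sup>2 * R * \<epsilon> * exp (4 * h)) * (exp (S i) / 2)" by simp
    also have "\<dots> \<le> 1 * (exp (S i) / 2)"
      using small unfolding K_def by (intro mult_right_mono) auto
    finally have d: "mnorm (itr B x i - itr D x i) \<le> exp (S i) / 2" by simp
    have "mnorm (itr B x i) \<le> mnorm (itr D x i) + mnorm (itr B x i - itr D x i)"
      using mnorm_triangle[of "itr D x i" "itr B x i - itr D x i"] by simp
    also have "\<dots> \<le> K * exp (S i + 2 * h) + exp (S i) / 2"
      using seg[of 0 i] less.prems d by (simp add: S0)
    also have "exp (S i) / 2 \<le> 1 * exp (S i + 2 * h)"
    proof -
      have "exp (S i) \<le> exp (S i + 2 * h)" using h by simp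
      then show ?thesis using exp_gt_zero[of "S i"] by linarith
    qed
    also have "\<dots> \<le> K * exp (S i + 2 * h)" using K by (intro mult_right_mono) auto
    finally show ?case using d by simp
  qed
  have "exp (S n) \<le> exp \<bar>S n\<bar>" by simp
  also have "\<dots> \<le> mnorm (itr D x n)" using mnorm_itr_eigenframe(1)[OF fr x kap] unfolding S_def .
  also have "\<dots> \<le> mnorm (itr B x n) + mnorm (itr B x n - itr D x n)"
    using mnorm_triangle[of "itr B x n" "itr D x n - itr B x n"] mnorm_minus_commute[of "itr D x n"] by simp
  also have "\<dots> \<le> mnorm (itr B x n) + exp (S n) / 2" using main[of n] by simp
  finally show "exp (S n) / 2 \<le> mnorm (itr B x n)" by simp
  show "mnorm (itr B x n) \<le> 4 / \<kappa> * exp (S n + 2 * h)" using main[of n] by (simp add: K_def)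
qed

text \<open>A crude comparison, exponential in \<open>n\<close>. It serves at one fixed scale, where
  the distance can be chosen small after \<open>n\<close>.\<close>

lemma mnorm_itr_diff_le:
  assumes A: "\<And>j. j \<in> {1..k} \<Longrightarrow> mnorm (A j) \<le> R" and D: "\<And>j. j \<in> {1..k} \<Longrightarrow> mnorm (D j) \<le> R"
    and x: "\<And>i. x i \<in> {1..k}" and R: "1 \<le> R"
    and eps: "\<And>j. j \<in> {1..k} \<Longrightarrow> mnorm (D j - A j) \<le> \<epsilon>" "0 \<le> \<epsilon>"
  shows "mnorm (itr D x n - itr A x n) \<le> real n * R ^ n * \<epsilon>"
proof -
  have "mnorm (itr A (\<lambda>t. x (t + int (Suc i))) (n - Suc i) ** ((D (x (int i)) - A (x (int i))) ** itr D x i))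
      \<le> R ^ n * \<epsilon>" (is "mnorm (?X ** (?Y ** ?Z)) \<le> _") if i: "i < n" for i
  proof -
    have "mnorm (?X ** (?Y ** ?Z)) \<le> mnorm ?X * (mnorm ?Y * mnorm ?Z)"
      by (rule order_trans[OF mnorm_mult_le]) (intro mult_left_mono mnorm_mult_le mnorm_nonneg)
    also have "\<dots> \<le> R ^ (n - Suc i) * (\<epsilon> * R ^ i)"
      using R eps(2) mnorm_itr_le[OF A, where x = "\<lambda>t. x (t + int (Suc i))"] mnorm_itr_le[OF D, where x = x] x
      by (intro mult_mono eps(1)) (auto simp: mnorm_nonneg)
    also have "\<dots> = R ^ (n - 1) * \<epsilon>" using i by (simp flip: power_add)
    also have "\<dots> \<le> R ^ n * \<epsilon>" using R eps(2) by (intro mult_right_mono power_increasing) auto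
    finally show ?thesis .
  qed
  then have "mnorm (itr D x n - itr A x n) \<le> (\<Sum>i<n. R ^ n * \<epsilon>)"
    unfolding itr_diff_telescope by (intro order_trans[OF mnorm_sum_le] sum_mono) simp
  then show ?thesis by simp
qed

section \<open>Transversality from the spectral gap\<close>

text \<open>Let \<open>w\<close> be the component of \<open>v\<close> orthogonal to
  \<open>u\<close>; its length is \<open>\<bar>cross2 u v\<bar>\<close>. Since
  \<open>(b j - a j) v = D j w - a j w\<close>, nearly parallel eigenlines force nearly equal
  eigenvalues.\<close>

lemma eigenframe_cross2_ge:
  assumes fr: "eigenframe k D u v a b" and j: "j \<in> {1..k}" and R: "mnorm (D j) \<le> R" "0 < R"
  shows "\<bar>a j - b j\<bar> / (2 * R) \<le> \<bar>cross2 u v\<bar>"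
proof -
  have ev: "D j *v u = a j *\<^sub>R u" "D j *v v = b j *\<^sub>R v" "norm u = 1" "norm v = 1"
    using fr j unfolding eigenframe_def by blast+
  define w where "w = v - (u \<bullet> v) *\<^sub>R u"
  have uu: "u \<bullet> u = 1" "v \<bullet> v = 1" using ev by (simp_all add: norm_eq_1)
  have "(norm w)\<^sup>2 = 1 - (u \<bullet> v)\<^sup>2"
    unfolding w_def power2_norm_eq_inner
    by (simp add: inner_diff_left inner_diff_right uu inner_commute power2_eq_square)
  also have "\<dots> = (cross2 u v)\<^sup>2" using cross2_sq[of u v] ev by simp
  finally have w: "norm w = \<bar>cross2 u v\<bar>" by (metis abs_norm_cancel power2_eq_iff_nonneg abs_ge_zero norm_ge_zero power2_abs)
  have "(b j - a j) *\<^sub>R v = D j *v w - a j *\<^sub>R w"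
    unfolding w_def by (simp add: matrix_vector_mult_diff_distrib matrix_vector_mult_scaleR ev algebra_simps)
  then have "\<bar>b j - a j\<bar> \<le> norm (D j *v w) + \<bar>a j\<bar> * norm w"
    using norm_triangle_ineq4[of "D j *v w" "a j *\<^sub>R w"] ev by (metis mult.right_neutral norm_scaleR)
  also have "\<dots> \<le> R * norm w + R * norm w"
    using mnorm_apply[of "D j" w] eigenvalue_le_mnorm[OF ev(1,3)] R
    by (intro add_mono mult_right_mono) (auto intro: order_trans[OF _ mult_right_mono])
  finally show ?thesis using R by (simp add: w field_simps abs_minus_commute)
qed

text \<open>The discriminant of the characteristic polynomial, trace squared minus four times the
  determinant, written in the entries so that continuity is immediate.\<close>

definition disc2 :: "mat2 \<Rightarrow> real" where
  "disc2 M = (M $ 1 $ 1 - M $ 2 $ 2)\<^sup>2 + 4 * (M $ 1 $ 2 * M $ 2 $ 1)"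

lemma isCont_disc2: "isCont disc2 M"
  unfolding disc2_def by (intro continuous_intros)

lemma disc2_eigenframe:
  assumes "eigenframe k D u v a b" "j \<in> {1..k}"
  shows "disc2 (D j) = (a j - b j)\<^sup>2"
proof -
  have ev: "D j *v u = a j *\<^sub>R u" "D j *v v = b j *\<^sub>R v" and c: "cross2 u v \<noteq> 0"
    using assms unfolding eigenframe_def by blast+
  have "det (D j) * cross2 u v = (a j * b j) * cross2 u v"
    using cross2_matrix[of "D j" u v] ev by (simp only: cross2_scaleR)
  then have d: "det (D j) = a j * b j" using c by simp
  have "(D j $ 1 $ 1 + D j $ 2 $ 2) * cross2 u v = cross2 (D j *v u) v + cross2 u (D j *v v)"
    unfolding cross2_def matrix_vector_mult_def by (simp add: sum_2 algebra_simps)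
  also have "\<dots> = (a j + b j) * cross2 u v"
    using cross2_scaleR[of "a j" u 1 v] cross2_scaleR[of 1 u "b j" v] ev by (simp add: algebra_simps)
  finally have t: "D j $ 1 $ 1 + D j $ 2 $ 2 = a j + b j" using c by simp
  have "disc2 (D j) = (D j $ 1 $ 1 + D j $ 2 $ 2)\<^sup>2 - 4 * det (D j)"
    unfolding disc2_def det_2 by (simp add: power2_eq_square algebra_simps)
  then show ?thesis unfolding t d by (simp add: power2_eq_square algebra_simps)
qed

section \<open>The Bernoulli product space\<close>

lemma prob_space_Xmeas: "prob_space (Xmeas P)"
  unfolding Xmeas_def by (intro prob_space_PiM measure_pmf.prob_space_axioms)

lemma measurable_letter: "(\<lambda>x. x i) \<in> measurable (Xmeas P) (count_space UNIV)"
proof -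
  have "(\<lambda>x. x i) \<in> measurable (Xmeas P) (measure_pmf P)"
    unfolding Xmeas_def by (rule measurable_component_singleton) simp
  then show ?thesis by simp
qed

lemma distr_letter: "distr (Xmeas P) (measure_pmf P) (\<lambda>x. x i) = measure_pmf P"
  unfolding Xmeas_def
  by (rule distr_PiM_component[where M = "\<lambda>_. measure_pmf P" and I = UNIV])
    (simp_all add: measure_pmf.prob_space_axioms)

lemma measurable_letter_fun:
  fixes f :: "nat \<Rightarrow> real"
  shows "(\<lambda>x. f (x i)) \<in> borel_measurable (Xmeas P)"
  by (rule measurable_compose[OF measurable_letter]) simp

text \<open>The iterate depends on finitely many letters from a countable alphabet. The induction
  absorbs the last factor into \<open>F\<close>, hence the generalization over
  \<open>F\<close>.\<close>

lemma measurable_itr: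
  fixes F :: "mat2 \<Rightarrow> real"
  shows "(\<lambda>x. F (itr B x n)) \<in> borel_measurable (Xmeas P)"
proof (induction n arbitrary: F)
  case (Suc n)
  show ?case unfolding itr.simps
    by (rule measurable_compose_countable[where f = "\<lambda>j x. F (B j ** itr B x n)",
          OF Suc.IH measurable_letter])
qed simp

lemma AE_letters:
  assumes "set_pmf P = {1..k}"
  shows "AE x in Xmeas P. \<forall>i. x i \<in> {1..k}"
  unfolding AE_all_countable
proof
  fix i
  show "AE x in Xmeas P. x i \<in> {1..k}"
    unfolding Xmeas_def
    by (rule AE_PiM_component[where M = "\<lambda>_. measure_pmf P" and I = UNIV])
      (simp_all add: measure_pmf.prob_space_axioms AE_measure_pmf_iff assms)
qed

text \<open>The joint law of the coordinates is the product measure itself, and each marginal is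
  \<open>P\<close>.\<close>

lemma indep_vars_letters:
  "prob_space.indep_vars (Xmeas P) (\<lambda>_. measure_pmf P) (\<lambda>i x. x i) UNIV"
proof -
  interpret prob_space "Xmeas P" by (rule prob_space_Xmeas)
  have "distr (Xmeas P) (\<Pi>\<^sub>M i\<in>UNIV. measure_pmf P) (\<lambda>x. \<lambda>i\<in>UNIV. x i) = Xmeas P"
    by (simp add: Xmeas_def distr_id2 restrict_UNIV)
  also have "\<dots> = (\<Pi>\<^sub>M i\<in>UNIV. distr (Xmeas P) (measure_pmf P) (\<lambda>x. x i))"
    unfolding distr_letter by (simp add: Xmeas_def)
  finally show ?thesis
    by (subst indep_vars_iff_distr_eq_PiM') (simp_all add: measurable_letter)
qed

section \<open>Concentration and its effect on expectations\<close>

text \<open>Hoeffding's inequality for the window of \<open>q\<close> letters starting at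
  \<open>s\<close>. The summands lie in an interval of length \<open>2 * C\<close>, which gives the
  constant in the exponent.\<close>

lemma Hoeffding_letters:
  fixes f :: "nat \<Rightarrow> real" and s q :: nat
  assumes supp: "set_pmf P = {1..k}" and f: "\<And>j. j \<in> {1..k} \<Longrightarrow> \<bar>f j\<bar> \<le> C" and "0 < C"
    and t: "0 \<le> t" and q: "0 < q"
  defines "m \<equiv> measure_pmf.expectation P f"
  shows "measure (Xmeas P) {x \<in> space (Xmeas P). (\<Sum>i<q. f (x (int (i + s)))) \<le> real q * m - t}
      \<le> exp (- t\<^sup>2 / (2 * real q * C\<^sup>2))"
    and "measure (Xmeas P) {x \<in> space (Xmeas P). \<bar>(\<Sum>i<q. f (x (int (i + s)))) - real q * m\<bar> \<ge> t}
      \<le> 2 * exp (- t\<^sup>2 / (2 * real q * C\<^sup>2))"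
proof -
  interpret prob_space "Xmeas P" by (rule prob_space_Xmeas)
  have ex: "expectation (\<lambda>x. f (x 0)) = m"
  proof -
    have "m = integral\<^sup>L (distr (Xmeas P) (measure_pmf P) (\<lambda>x. x 0)) f"
      unfolding m_def distr_letter ..
    also have "\<dots> = expectation (\<lambda>x. f (x 0))"
      by (rule integral_distr) (simp_all add: measurable_letter)
    finally show ?thesis ..
  qed
  define I where "I = (\<lambda>i. int (i + s)) ` {..<q}"
  have inj: "inj_on (\<lambda>i. int (i + s)) {..<q}" by (simp add: inj_on_def)
  have card: "card I = q" unfolding I_def card_image[OF inj] by simp
  have sumI: "(\<Sum>i\<in>I. f (x i)) = (\<Sum>i<q. f (x (int (i + s))))" for x
    unfolding I_def sum.reindex[OF inj] by simp
  have ind: "indep_vars (\<lambda>_. borel) (\<lambda>i x. f (x i)) I"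
    by (rule indep_vars_subset[OF indep_vars_compose2[OF indep_vars_letters]]) simp_all
  have dis: "distr (Xmeas P) borel (\<lambda>x. f (x i)) = distr (measure_pmf P) borel f" for i
  proof -
    have "distr (measure_pmf P) borel f = distr (distr (Xmeas P) (measure_pmf P) (\<lambda>x. x i)) borel f"
      by (simp add: distr_letter)
    also have "\<dots> = distr (Xmeas P) borel (\<lambda>x. f (x i))"
      by (subst distr_distr) (simp_all add: measurable_letter comp_def)
    finally show ?thesis ..
  qed
  interpret H: Hoeffding_ineq_iid "Xmeas P" I "\<lambda>i x. f (x i)" "\<lambda>x. f (x 0)" "- C" C m
  proof unfold_locales
    show "AE x in Xmeas P. f (x 0) \<in> {- C..C}"
      using AE_letters[OF supp] by eventually_elim (use f in \<open>auto simp: abs_le_iff minus_le_iff\<close>)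
  qed (use ind in \<open>simp_all add: I_def dis ex measurable_letter_fun\<close>)
  have e: "-2 * t\<^sup>2 / (real (card I) * (C - - C)\<^sup>2) = - t\<^sup>2 / (2 * real q * C\<^sup>2)"
    unfolding card using q \<open>0 < C\<close> by (simp add: field_simps power2_eq_square)
  have ne: "I \<noteq> {}" "- C < C" using q \<open>0 < C\<close> card by auto
  show "prob {x \<in> space (Xmeas P). (\<Sum>i<q. f (x (int (i + s)))) \<le> real q * m - t}
      \<le> exp (- t\<^sup>2 / (2 * real q * C\<^sup>2))"
    using H.Hoeffding_ineq_le[OF t ne(2,1)] unfolding e sumI unfolding card .
  show "prob {x \<in> space (Xmeas P). \<bar>(\<Sum>i<q. f (x (int (i + s)))) - real q * m\<bar> \<ge> t}
      \<le> 2 * exp (- t\<^sup>2 / (2 * real q * C\<^sup>2))"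
    using H.Hoeffding_ineq_abs_ge[OF t ne(2,1)] unfolding e sumI unfolding card .
qed

text \<open>Splits the integral at the exceptional event \<open>N\<close>; it converts typical
  behaviour of log-norms into estimates of \<open>Ln\<close>.\<close>

lemma (in prob_space) expectation_close:
  fixes Y :: "'a \<Rightarrow> real"
  assumes Y: "Y \<in> borel_measurable M" and N: "N \<in> events"
    and good: "AE x in M. x \<notin> N \<longrightarrow> \<bar>Y x - m\<bar> \<le> \<theta>"
    and bad: "AE x in M. \<bar>Y x - m\<bar> \<le> c" and "0 \<le> \<theta>" "0 \<le> c"
  shows "\<bar>expectation Y - m\<bar> \<le> \<theta> + c * prob N"
proof -
  have int: "integrable M (\<lambda>x. Y x - m)"
    using bad Y by (intro integrable_const_bound[where B = c]) auto
  have "integrable M (\<lambda>x. (Y x - m) + m)" by (intro Bochner_Integration.integrable_add int) simp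
  then have intY: "integrable M Y" by simp
  have intN: "integrable M (\<lambda>x. c * indicator N x)"
    using N by (auto simp: emeasure_eq_measure)
  have "expectation Y - m = expectation (\<lambda>x. Y x - m)"
    using intY by (simp add: prob_space)
  then have "\<bar>expectation Y - m\<bar> \<le> expectation (\<lambda>x. \<bar>Y x - m\<bar>)" by simp
  also have "\<dots> \<le> expectation (\<lambda>x. \<theta> + c * indicator N x)"
  proof (rule integral_mono_AE)
    show "AE x in M. \<bar>Y x - m\<bar> \<le> \<theta> + c * indicator N x"
      using good bad by eventually_elim (use assms in \<open>auto simp: indicator_def split: if_splits\<close>)
  qed (use int intN in auto)
  also have "\<dots> = \<theta> + c * prob N"
    using N intN by (subst Bochner_Integration.integral_add) (simp_all add: prob_space)
  finally show ?thesis .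
qed

section \<open>Uniformity over diagonal cocycles near A\<close>

lemma abs_ln_diff_le:
  fixes s t :: real
  assumes "1 \<le> s" "1 \<le> t"
  shows "\<bar>ln s - ln t\<bar> \<le> \<bar>s - t\<bar>"
proof -
  have "ln s - ln t \<le> \<bar>s - t\<bar>" if "1 \<le> s" "1 \<le> t" for s t :: real
  proof -
    have "ln s - ln t \<le> (s - t) / t" using that by (intro ln_diff_le) auto
    also have "\<dots> \<le> \<bar>s - t\<bar> / t" using that by (intro divide_right_mono) auto
    also have "\<dots> \<le> \<bar>s - t\<bar>" using that by (simp add: divide_le_eq mult_le_cancel_left1)
    finally show ?thesis .
  qed
  from this[of s t] this[of t s] show ?thesis using assms by (auto simp: abs_le_iff abs_minus_commute)
qed

lemma ln_mnorm_itr_bounds: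
  assumes B: "SL2_cocycle k B" and x: "\<And>i. x i \<in> {1..k}"
    and R: "\<And>j. j \<in> {1..k} \<Longrightarrow> mnorm (B j) \<le> R" "1 < R"
  shows "0 \<le> ln (mnorm (itr B x n)) / real n" "ln (mnorm (itr B x n)) / real n \<le> ln R"
proof -
  have ge: "1 \<le> mnorm (itr B x n)" by (rule mnorm_itr_ge_1[OF B x])
  then show "0 \<le> ln (mnorm (itr B x n)) / real n" by simp
  have "ln (mnorm (itr B x n)) \<le> ln (R ^ n)"
    using ge mnorm_itr_le[where B = B and x = x and k = k and n = n and R = R, OF R(1) x] R(2) by (subst ln_le_cancel_iff) auto
  then show "ln (mnorm (itr B x n)) / real n \<le> ln R"
    using R(2) by (cases "n = 0") (simp_all add: ln_realpow divide_le_eq mult.commute)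
qed

lemma abs_expectation_le:
  fixes f :: "nat \<Rightarrow> real"
  assumes "set_pmf P = {1..k}" "\<And>j. j \<in> {1..k} \<Longrightarrow> \<bar>f j\<bar> \<le> C" "0 \<le> C"
  shows "\<bar>measure_pmf.expectation P f\<bar> \<le> C"
  using measure_pmf.expectation_close[of f P "{}" 0 C C] assms by (simp add: AE_measure_pmf_iff)

lemma abs_average_le:
  fixes y c m :: real and n :: nat
  assumes "0 < n" "\<bar>y - real n * m\<bar> \<le> c"
  shows "\<bar>y / real n - m\<bar> \<le> c / real n"
proof -
  have "y / real n - m = (y - real n * m) / real n" using assms(1) by (simp add: field_simps)
  then show ?thesis using assms by (simp add: abs_divide divide_right_mono)
qed

section \<open>Finite scale exponents of diagonal cocycles\<close>

text \<open>The log-norm is \<open>\<bar>S\<bar>\<close> up to \<open>ln (2 / \<kappa>)\<close>, and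
  Hoeffding keeps \<open>S\<close> within \<open>n * \<eta>\<close> of \<open>n * m\<close>. The
  bound sees \<open>D\<close> only through \<open>\<kappa>\<close> and \<open>R\<close>, which is
  the source of uniformity.\<close>

lemma Ln_close_mean:
  fixes n :: nat
  assumes supp: "set_pmf P = {1..k}" and D: "Diag k D" and fr: "eigenframe k D u v a b"
    and kap: "0 < \<kappa>" "\<kappa> \<le> \<bar>cross2 u v\<bar>"
    and R: "\<And>j. j \<in> {1..k} \<Longrightarrow> mnorm (D j) \<le> R" "1 < R" and n: "0 < n" and eta: "0 \<le> \<eta>"
  defines "m \<equiv> measure_pmf.expectation P (\<lambda>j. ln \<bar>a j\<bar>)"
  shows "\<bar>Ln P D n - \<bar>m\<bar>\<bar> \<le> ln (2 / \<kappa>) / real n + \<eta> + 2 * ln R * (2 * exp (- (real n * \<eta>\<^sup>2 / (2 * (ln R)\<^sup>2))))"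
proof -
  interpret prob_space "Xmeas P" by (rule prob_space_Xmeas)
  define S where "S = (\<lambda>x :: int \<Rightarrow> nat. \<Sum>t<n. ln \<bar>a (x (int t))\<bar>)"
  define N where "N = {x \<in> space (Xmeas P). \<bar>S x - real n * m\<bar> \<ge> real n * \<eta>}"
  have C: "0 < ln R" using R by simp
  have f: "\<bar>ln \<bar>a j\<bar>\<bar> \<le> ln R" if "j \<in> {1..k}" for j
    using eigenframe_ln_bound[OF fr that R(1)[OF that]] R by simp
  have m: "\<bar>m\<bar> \<le> ln R" unfolding m_def using supp f C by (intro abs_expectation_le) auto
  have SL: "SL2_cocycle k D" using D unfolding Diag_def by blast
  have Smeas: "S \<in> borel_measurable (Xmeas P)"
    unfolding S_def by (intro borel_measurable_sum measurable_letter_fun)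
  then have N: "N \<in> events" unfolding N_def by measurable
  have "prob N \<le> 2 * exp (- (real n * \<eta>)\<^sup>2 / (2 * real n * (ln R)\<^sup>2))"
    using Hoeffding_letters(2)[where f = "\<lambda>j. ln \<bar>a j\<bar>" and t = "real n * \<eta>" and q = n and s = 0, OF supp f C] n eta unfolding N_def S_def m_def by simp
  also have "- (real n * \<eta>)\<^sup>2 / (2 * real n * (ln R)\<^sup>2) = - (real n * \<eta>\<^sup>2 / (2 * (ln R)\<^sup>2))"
    using n by (simp add: power2_eq_square)
  finally have pN: "prob N \<le> 2 * exp (- (real n * \<eta>\<^sup>2 / (2 * (ln R)\<^sup>2)))" .
  have "\<kappa> \<le> 1" using kap cross2_le[of u v] fr unfolding eigenframe_def by auto
  then have lK: "0 \<le> ln (2 / \<kappa>)" using kap by simp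
  have "\<bar>Ln P D n - \<bar>m\<bar>\<bar> \<le> (ln (2 / \<kappa>) / real n + \<eta>) + 2 * ln R * prob N"
    unfolding Ln_def
  proof (rule expectation_close)
    show "(\<lambda>x. ln (mnorm (itr D x n)) / real n) \<in> borel_measurable (Xmeas P)" by (rule measurable_itr)
    show "AE x in Xmeas P. x \<notin> N \<longrightarrow> \<bar>ln (mnorm (itr D x n)) / real n - \<bar>m\<bar>\<bar> \<le> ln (2 / \<kappa>) / real n + \<eta>"
      using AE_letters[OF supp] AE_space
    proof eventually_elim
      case (elim x)
      then have x: "\<And>i. x i \<in> {1..k}" by blast
      show ?case
      proof
        assume "x \<notin> N"
        then have dev: "\<bar>S x - real n * m\<bar> \<le> real n * \<eta>" using elim unfolding N_def by simp
        have "exp \<bar>S x\<bar> \<le> mnorm (itr D x n)" "mnorm (itr D x n) \<le> 2 / \<kappa> * exp \<bar>S x\<bar>"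
          using mnorm_itr_eigenframe[where x = x and n = n, OF fr x kap] unfolding S_def by blast+
        moreover have "0 < mnorm (itr D x n)" using mnorm_itr_ge_1[where x = x and n = n, OF SL x] by linarith
        ultimately have "ln (exp \<bar>S x\<bar>) \<le> ln (mnorm (itr D x n))"
            "ln (mnorm (itr D x n)) \<le> ln (2 / \<kappa> * exp \<bar>S x\<bar>)"
          using kap by (subst ln_le_cancel_iff; simp)+
        moreover have "ln (2 / \<kappa> * exp \<bar>S x\<bar>) = ln (2 / \<kappa>) + \<bar>S x\<bar>" using kap by (subst ln_mult) auto
        ultimately have "\<bar>ln (mnorm (itr D x n)) - \<bar>S x\<bar>\<bar> \<le> ln (2 / \<kappa>)" using lK by auto
        moreover have "\<bar>\<bar>S x\<bar> - real n * \<bar>m\<bar>\<bar> \<le> real n * \<eta>"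
          using dev abs_triangle_ineq3[of "S x" "real n * m"] by (simp add: abs_mult)
        ultimately have "\<bar>ln (mnorm (itr D x n)) - real n * \<bar>m\<bar>\<bar> \<le> ln (2 / \<kappa>) + real n * \<eta>" by linarith
        from abs_average_le[OF n this]
        show "\<bar>ln (mnorm (itr D x n)) / real n - \<bar>m\<bar>\<bar> \<le> ln (2 / \<kappa>) / real n + \<eta>"
          using n by (simp add: add_divide_distrib)
      qed
    qed
    show "AE x in Xmeas P. \<bar>ln (mnorm (itr D x n)) / real n - \<bar>m\<bar>\<bar> \<le> 2 * ln R"
      using AE_letters[OF supp]
    proof eventually_elim
      case (elim x)
      then have x: "\<And>i. x i \<in> {1..k}" by blast
      from ln_mnorm_itr_bounds[where x = x and n = n, OF SL x R] m C show ?case by (auto simp: abs_le_iff)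
    qed
  qed (use N lK n eta C in auto)
  also have "\<dots> \<le> ln (2 / \<kappa>) / real n + \<eta> + 2 * ln R * (2 * exp (- (real n * \<eta>\<^sup>2 / (2 * (ln R)\<^sup>2))))"
    using pN C by (intro add_left_mono mult_left_mono) auto
  finally show ?thesis .
qed

text \<open>The logarithm is 1-Lipschitz on norms at least 1, and the average over \<open>n\<close>
  cancels the factor \<open>n\<close> from the telescoped error.\<close>

lemma Ln_diff_le:
  fixes n :: nat
  assumes supp: "set_pmf P = {1..k}" and A: "SL2_cocycle k A" and D: "SL2_cocycle k D"
    and R: "\<And>j. j \<in> {1..k} \<Longrightarrow> mnorm (A j) \<le> R" "\<And>j. j \<in> {1..k} \<Longrightarrow> mnorm (D j) \<le> R" "1 < R"
    and eps: "\<And>j. j \<in> {1..k} \<Longrightarrow> mnorm (D j - A j) \<le> \<epsilon>" "0 \<le> \<epsilon>" and n: "0 < n"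
  shows "\<bar>Ln P D n - Ln P A n\<bar> \<le> R ^ n * \<epsilon>"
proof -
  interpret prob_space "Xmeas P" by (rule prob_space_Xmeas)
  define Y where "Y = (\<lambda>B x. ln (mnorm (itr B x n)) / real n)"
  have meas: "Y B \<in> borel_measurable (Xmeas P)" for B unfolding Y_def by (rule measurable_itr)
  have int: "integrable (Xmeas P) (Y B)"
    if "SL2_cocycle k B" "\<And>j. j \<in> {1..k} \<Longrightarrow> mnorm (B j) \<le> R" for B
  proof (rule integrable_const_bound[where B = "ln R"])
    show "AE x in Xmeas P. norm (Y B x) \<le> ln R"
      using AE_letters[OF supp]
    proof eventually_elim
      case (elim x)
      then have x: "\<And>i. x i \<in> {1..k}" by blast
      show ?case using ln_mnorm_itr_bounds[where x = x and n = n, OF that(1) x that(2) R(3)] unfolding Y_def by simp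
    qed
  qed (rule meas)
  have bnd: "AE x in Xmeas P. \<bar>(Y D x - Y A x) - 0\<bar> \<le> R ^ n * \<epsilon>"
    using AE_letters[OF supp]
  proof eventually_elim
    case (elim x)
    then have x: "\<And>i. x i \<in> {1..k}" by blast
    have "\<bar>ln (mnorm (itr D x n)) - ln (mnorm (itr A x n))\<bar> \<le> \<bar>mnorm (itr D x n) - mnorm (itr A x n)\<bar>"
      by (intro abs_ln_diff_le mnorm_itr_ge_1[where x = x, OF D x] mnorm_itr_ge_1[where x = x, OF A x])
    also have "\<dots> \<le> mnorm (itr D x n - itr A x n)"
      using mnorm_triangle[of "itr D x n - itr A x n" "itr A x n"]
        mnorm_triangle[of "itr A x n - itr D x n" "itr D x n"] mnorm_minus_commute[of "itr D x n" "itr A x n"]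
      by simp
    also have "\<dots> \<le> real n * R ^ n * \<epsilon>" using R(3) by (intro mnorm_itr_diff_le[where x = x and A = A and D = D and R = R and k = k, OF R(1,2) x _ eps]) auto
    finally have "\<bar>ln (mnorm (itr D x n)) - ln (mnorm (itr A x n))\<bar> / real n \<le> real n * R ^ n * \<epsilon> / real n"
      by (rule divide_right_mono) simp
    moreover have "\<bar>Y D x - Y A x\<bar> = \<bar>ln (mnorm (itr D x n)) - ln (mnorm (itr A x n))\<bar> / real n"
      unfolding Y_def by (simp add: abs_divide flip: diff_divide_distrib)
    ultimately show ?case using n by simp
  qed
  have "\<bar>expectation (\<lambda>x. Y D x - Y A x) - 0\<bar> \<le> R ^ n * \<epsilon> + R ^ n * \<epsilon> * prob {}"
    by (rule expectation_close[OF _ _ _ bnd]) (use meas bnd R(3) eps(2) in auto)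
  moreover have "expectation (\<lambda>x. Y D x - Y A x) = Ln P D n - Ln P A n"
    unfolding Ln_def Y_def[symmetric]
    using int[OF D R(2)] int[OF A R(1)] by (simp add: Y_def)
  ultimately show ?thesis by simp
qed

lemma mean_error_tendsto:
  fixes K C \<eta> :: real
  assumes "0 < C" "0 < \<eta>"
  shows "(\<lambda>n. K / real n + \<eta> + 2 * C * (2 * exp (- (real n * \<eta>\<^sup>2 / (2 * C\<^sup>2))))) \<longlonglongrightarrow> \<eta>"
proof -
  define c where "c = \<eta>\<^sup>2 / (2 * C\<^sup>2)"
  have "0 < c" using assms by (simp add: c_def)
  then have "(\<lambda>n. K / real n + \<eta> + 2 * C * (2 * exp (- (real n * c)))) \<longlonglongrightarrow> \<eta>" by real_asymp
  then show ?thesis by (simp add: c_def)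
qed

text \<open>Identifies the Lyapunov exponent of a diagonal cocycle, so that positivity of
  \<open>Lyap\<close> becomes nonvanishing of the mean.\<close>

lemma Ln_tendsto_mean:
  assumes supp: "set_pmf P = {1..k}" and D: "Diag k D" and fr: "eigenframe k D u v a b"
    and R: "\<And>j. j \<in> {1..k} \<Longrightarrow> mnorm (D j) \<le> R" "1 < R"
  shows "(\<lambda>n. Ln P D n) \<longlonglongrightarrow> \<bar>measure_pmf.expectation P (\<lambda>j. ln \<bar>a j\<bar>)\<bar>" (is "_ \<longlonglongrightarrow> \<bar>?m\<bar>")
proof (rule LIMSEQ_I)
  fix e :: real assume e: "0 < e"
  have kap: "0 < \<bar>cross2 u v\<bar>" using fr unfolding eigenframe_def by simp
  define err where "err = (\<lambda>n. ln (2 / \<bar>cross2 u v\<bar>) / real n + e / 2 +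
    2 * ln R * (2 * exp (- (real n * (e / 2)\<^sup>2 / (2 * (ln R)\<^sup>2)))))"
  have "err \<longlonglongrightarrow> e / 2" unfolding err_def using R(2) e by (intro mean_error_tendsto) auto
  then have "\<forall>\<^sub>F n in sequentially. err n < e" by (rule order_tendstoD) (use e in simp)
  then obtain n0 where n0: "\<And>n. n \<ge> n0 \<Longrightarrow> err n < e" unfolding eventually_sequentially by blast
  \<comment> \<open>Starting at \<open>Suc n0\<close> keeps \<open>n\<close> positive.\<close>
  have "norm (Ln P D n - \<bar>?m\<bar>) < e" if "Suc n0 \<le> n" for n
    using Ln_close_mean[OF supp D fr kap order_refl R, of n "e / 2"] n0[of n] e that
    unfolding err_def by simp
  then show "\<exists>no. \<forall>n\<ge>no. norm (Ln P D n - \<bar>?m\<bar>) < e" by blast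
qed

lemma expectation_eigenframe_swap:
  assumes "set_pmf P = {1..k}" "eigenframe k D u v a b"
  shows "measure_pmf.expectation P (\<lambda>j. ln \<bar>b j\<bar>) = - measure_pmf.expectation P (\<lambda>j. ln \<bar>a j\<bar>)"
proof -
  have "measure_pmf.expectation P (\<lambda>j. ln \<bar>b j\<bar>) = measure_pmf.expectation P (\<lambda>j. - ln \<bar>a j\<bar>)"
    using assms eigenframe_nonzero(3)[OF assms(2)]
    by (intro integral_cong_AE) (auto simp: AE_measure_pmf_iff)
  then show ?thesis by simp
qed

text \<open>
  Transversality is uniform because \<open>disc2\<close> of one hyperbolic letter stays away from zero; the mean is
  uniform because \<open>Ln\<close> approximates its absolute value at a rate depending only on the transversality.
\<close>

lemma uniform_eigenframes:
  assumes supp: "set_pmf P = {1..k}" and A: "Diag k A" and L: "Lyap P A > 0"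
  obtains \<delta> \<kappa> \<mu> R :: real where "0 < \<delta>" "0 < \<kappa>" "0 < \<mu>" "1 < R"
    "\<And>B j. j \<in> {1..k} \<Longrightarrow> mnorm (B j - A j) \<le> \<delta> \<Longrightarrow> mnorm (B j) \<le> R"
    "\<And>D. Diag k D \<Longrightarrow> \<forall>j\<in>{1..k}. mnorm (D j - A j) \<le> \<delta> \<Longrightarrow>
      \<exists>u v a b. eigenframe k D u v a b \<and> \<kappa> \<le> \<bar>cross2 u v\<bar> \<and>
        \<mu> \<le> measure_pmf.expectation P (\<lambda>j. ln \<bar>a j\<bar>)"
proof -
  obtain u0 v0 a0 b0 where fr0: "eigenframe k A u0 v0 a0 b0" using Diag_eigenframe[OF A] .
  have SLA: "SL2_cocycle k A" using A unfolding Diag_def by blast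
  \<comment> \<open>Leaves room for perturbations of size 1 and exceeds 1, so that
    \<open>ln R\<close> is positive.\<close>
  define R where "R = 2 + (\<Sum>j\<in>{1..k}. mnorm (A j))"
  have R1: "1 < R" unfolding R_def by (rule order_less_le_trans[of _ 2]) (auto intro!: sum_nonneg mnorm_nonneg)
  have AR: "mnorm (A j) \<le> R - 1" if "j \<in> {1..k}" for j
    using member_le_sum[OF that, of "\<lambda>j. mnorm (A j)"] mnorm_nonneg unfolding R_def by simp
  have BR: "mnorm (B j) \<le> R" if "j \<in> {1..k}" "mnorm (B j - A j) \<le> 1" for j and B :: "nat \<Rightarrow> mat2"
    using mnorm_triangle[of "B j - A j" "A j"] AR[OF that(1)] that(2) by simp
  have AR': "mnorm (A j) \<le> R" if "j \<in> {1..k}" for j using AR[OF that] by simp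
  define m0 where "m0 = measure_pmf.expectation P (\<lambda>j. ln \<bar>a0 j\<bar>)"
  have "(\<lambda>n. Ln P A n) \<longlonglongrightarrow> \<bar>m0\<bar>"
    unfolding m0_def by (rule Ln_tendsto_mean[OF supp A fr0 AR' R1])
  then have m0: "0 < \<bar>m0\<bar>" using L unfolding Lyap_def by (simp add: limI)
  \<comment> \<open>A nonzero mean forces a hyperbolic letter, whose discriminant is positive and
    stays at least half as large nearby.\<close>
  obtain j0 where j0: "j0 \<in> {1..k}" "ln \<bar>a0 j0\<bar> \<noteq> 0"
  proof (rule ccontr)
    assume "\<not> thesis"
    then have "\<And>j. j \<in> {1..k} \<Longrightarrow> ln \<bar>a0 j\<bar> = 0" using that by blast
    then have "\<bar>m0\<bar> \<le> 0" unfolding m0_def by (intro abs_expectation_le[OF supp]) auto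
    then show False using m0 by simp
  qed
  have "a0 j0 \<noteq> b0 j0"
    using eigenframe_nonzero(3)[OF fr0 j0(1)] j0(2) by auto
  then have g: "0 < disc2 (A j0)" unfolding disc2_eigenframe[OF fr0 j0(1)] by simp
  define g where "g = sqrt (disc2 (A j0) / 2)"
  have g0: "0 < g" using g by (simp add: g_def)
  have "\<forall>\<^sub>F M in nhds (A j0). disc2 (A j0) / 2 < disc2 M"
    using isCont_disc2[of "A j0"] g unfolding isCont_def tendsto_at_iff_tendsto_nhds
    by (intro order_tendstoD(1)[of disc2 "disc2 (A j0)"]) auto
  then obtain d where d: "0 < d" "\<And>M. dist M (A j0) < d \<Longrightarrow> disc2 (A j0) / 2 < disc2 M"
    unfolding eventually_nhds_metric by blast
  \<comment> \<open>The minimum serves \<open>A\<close> and all nearby \<open>D\<close> at once,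
    since the exponents of both are compared with their means.\<close>
  define \<kappa> where "\<kappa> = min \<bar>cross2 u0 v0\<bar> (g / (2 * R))"
  have kap: "0 < \<kappa>" "\<kappa> \<le> \<bar>cross2 u0 v0\<bar>" "\<kappa> \<le> g / (2 * R)"
    using fr0 g0 R1 unfolding \<kappa>_def eigenframe_def by auto
  \<comment> \<open>Budget: the mean errors for \<open>A\<close> and for \<open>D\<close> and the
    gap between their exponents each cost at most a quarter of \<open>\<bar>m0\<bar>\<close>, which
    leaves a quarter for the mean of \<open>D\<close>.\<close>
  define \<eta> where "\<eta> = \<bar>m0\<bar> / 8"
  define err where "err = (\<lambda>n. ln (2 / \<kappa>) / real n + \<eta> + 2 * ln R * (2 * exp (- (real n * \<eta>\<^sup>2 / (2 * (ln R)\<^sup>2)))))"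
  have "err \<longlonglongrightarrow> \<eta>" unfolding err_def using R1 m0 by (intro mean_error_tendsto) (auto simp: \<eta>_def)
  then have "\<forall>\<^sub>F n in sequentially. err n < \<bar>m0\<bar> / 4" by (rule order_tendstoD) (use m0 in \<open>simp add: \<eta>_def\<close>)
  then have "\<forall>\<^sub>F n in sequentially. 0 < n \<and> err n < \<bar>m0\<bar> / 4"
    using eventually_gt_at_top[of 0] by eventually_elim simp
  from eventually_happens'[OF sequentially_bot this]
  obtain n where n: "0 < n" "err n < \<bar>m0\<bar> / 4" by blast
  \<comment> \<open>The three bounds serve the norm bound \<open>R\<close>, the discriminant (with
    the factor 4 from \<open>norm_le_mnorm\<close>), and the comparison of exponents at the fixed
    scale \<open>n\<close>.\<close>
  define \<delta> where "\<delta> = min (min 1 (d / 8)) (\<bar>m0\<bar> / (4 * R ^ n))"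
  have del: "0 < \<delta>" "\<delta> \<le> 1" "\<delta> \<le> d / 8" "\<delta> \<le> \<bar>m0\<bar> / (4 * R ^ n)"
    using d(1) m0 R1 unfolding \<delta>_def by auto
  have main: "\<exists>u v a b. eigenframe k D u v a b \<and> \<kappa> \<le> \<bar>cross2 u v\<bar> \<and>
        \<bar>m0\<bar> / 4 \<le> measure_pmf.expectation P (\<lambda>j. ln \<bar>a j\<bar>)"
    if D: "Diag k D" and near: "\<forall>j\<in>{1..k}. mnorm (D j - A j) \<le> \<delta>" for D
  proof -
    have DA: "mnorm (D j - A j) \<le> \<delta>" if "j \<in> {1..k}" for j using near that by blast
    obtain u v a b where fr: "eigenframe k D u v a b" using Diag_eigenframe[OF D] .
    have SLD: "SL2_cocycle k D" using D unfolding Diag_def by blast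
    have DR: "mnorm (D j) \<le> R" if "j \<in> {1..k}" for j
      using BR[where B = D, OF that] DA[OF that] del(2) by linarith
    have "norm (D j0 - A j0) < d" using norm_le_mnorm[of "D j0 - A j0"] DA[OF j0(1)] del(3) d(1) by linarith
    then have "disc2 (A j0) / 2 < (a j0 - b j0)\<^sup>2"
      using d(2) unfolding dist_norm disc2_eigenframe[OF fr j0(1), symmetric] by blast
    then have "g \<le> \<bar>a j0 - b j0\<bar>"
      using real_sqrt_le_mono[of "disc2 (A j0) / 2" "(a j0 - b j0)\<^sup>2"] by (simp add: g_def)
    then have "g / (2 * R) \<le> \<bar>a j0 - b j0\<bar> / (2 * R)" using R1 by (intro divide_right_mono) auto
    also have "\<dots> \<le> \<bar>cross2 u v\<bar>" using eigenframe_cross2_ge[OF fr j0(1) DR[OF j0(1)]] R1 by simp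
    finally have c: "\<kappa> \<le> \<bar>cross2 u v\<bar>" using kap(3) by simp
    define m where "m = measure_pmf.expectation P (\<lambda>j. ln \<bar>a j\<bar>)"
    have eta: "0 \<le> \<eta>" by (simp add: \<eta>_def)
    have 1: "\<bar>Ln P D n - \<bar>m\<bar>\<bar> \<le> err n"
      unfolding m_def err_def by (rule Ln_close_mean[OF supp D fr kap(1) c DR R1 n(1) eta])
    have 2: "\<bar>Ln P A n - \<bar>m0\<bar>\<bar> \<le> err n"
      unfolding m0_def err_def by (rule Ln_close_mean[OF supp A fr0 kap(1,2) AR' R1 n(1) eta])
    have "\<bar>Ln P D n - Ln P A n\<bar> \<le> R ^ n * \<delta>"
      using del(1) by (intro Ln_diff_le[OF supp SLA SLD AR' DR R1 DA _ n(1)]) auto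
    also have "\<dots> \<le> \<bar>m0\<bar> / 4" using del(4) R1 by (simp add: field_simps)
    finally have m: "\<bar>m0\<bar> / 4 \<le> \<bar>m\<bar>" using 1 2 n(2) by linarith
    show ?thesis
    proof (cases "0 \<le> m")
      case True
      then show ?thesis using fr c m unfolding m_def by (metis abs_of_nonneg)
    next
      \<comment> \<open>With a negative mean the expanding line is \<open>v\<close>, so the frame is
        swapped.\<close>
      case False
      have "\<kappa> \<le> \<bar>cross2 v u\<bar>" using c by (simp add: cross2_def abs_minus_commute mult.commute)
      moreover have "\<bar>m0\<bar> / 4 \<le> measure_pmf.expectation P (\<lambda>j. ln \<bar>b j\<bar>)"
        using False m unfolding m_def expectation_eigenframe_swap[OF supp fr] by simp
      ultimately show ?thesis using eigenframe_swap[OF fr] by blast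
    qed
  qed
  show thesis
  proof (rule that[of \<delta> \<kappa> "\<bar>m0\<bar> / 4" R])
    show "0 < \<bar>m0\<bar> / 4" using m0 by simp
    show "mnorm (B j) \<le> R" if "j \<in> {1..k}" "mnorm (B j - A j) \<le> \<delta>" for B j
      using BR[where B = B, OF that(1)] that(2) del(2) by linarith
  qed (use del kap R1 main in blast)+
qed

section \<open>Deviation estimate\<close>

text \<open>Off the exceptional events \<open>N1\<close> (a segment sum drops to \<open>- h\<close>)
  and \<open>N2\<close> (the total sum deviates), shadowing puts the averaged log-norm within
  \<open>3 * \<theta> / 8\<close> of \<open>m\<close>. Integration puts \<open>Ln P B n\<close>
  within \<open>\<theta> / 2\<close> of \<open>m\<close>, so a deviation above
  \<open>\<theta>\<close> can occur only on these events, up to a null set.\<close>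

lemma deviation_bound:
  fixes n :: nat
  assumes supp: "set_pmf P = {1..k}" and B: "SL2_cocycle k B" and fr: "eigenframe k D u v a b"
    and kap: "0 < \<kappa>" "\<kappa> \<le> \<bar>cross2 u v\<bar>"
    and R: "\<And>j. j \<in> {1..k} \<Longrightarrow> mnorm (B j) \<le> R" "\<And>j. j \<in> {1..k} \<Longrightarrow> mnorm (D j) \<le> R" "1 < R"
    and mu: "0 < \<mu>" "\<mu> \<le> measure_pmf.expectation P (\<lambda>j. ln \<bar>a j\<bar>)"
    and eps: "\<And>j. j \<in> {1..k} \<Longrightarrow> mnorm (B j - D j) \<le> \<epsilon>" "0 \<le> \<epsilon>"
    and h: "0 \<le> h" and n: "0 < n" and theta: "0 < \<theta>"
    and small: "4 * real n * (2 / \<kappa>)\<^sup>2 * R * \<epsilon> * exp (4 * h) \<le> 1"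
    and err: "(2 * h + ln (4 / \<kappa>)) / real n \<le> \<theta> / 8"
    and prob: "(real n + 1)\<^sup>2 * exp (- (2 * \<mu> / (ln R)\<^sup>2 * h)) + 2 * exp (- (real n * \<theta>\<^sup>2 / (32 * (ln R)\<^sup>2))) \<le> \<pi>"
    and pi: "2 * ln R * \<pi> \<le> \<theta> / 8"
  shows "measure (Xmeas P)
    {x \<in> space (Xmeas P). \<bar>ln (mnorm (itr B x n)) / real n - Ln P B n\<bar> > \<theta>} \<le> \<pi>"
proof -
  interpret prob_space "Xmeas P" by (rule prob_space_Xmeas)
  define f where "f = (\<lambda>j. ln \<bar>a j\<bar>)"
  define m where "m = measure_pmf.expectation P f"
  have m: "\<mu> \<le> m" using mu unfolding m_def f_def by simp
  have C: "0 < ln R" using R(3) by simp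
  have f: "\<bar>f j\<bar> \<le> ln R" if "j \<in> {1..k}" for j
    using eigenframe_ln_bound[OF fr that R(2)[OF that]] R(3) unfolding f_def by simp
  have mC: "\<bar>m\<bar> \<le> ln R" unfolding m_def using supp f C by (intro abs_expectation_le) auto
  define S where "S = (\<lambda>s q (x :: int \<Rightarrow> nat). \<Sum>t<q. f (x (int (t + s))))"
  have Smeas: "S s q \<in> borel_measurable (Xmeas P)" for s q
    unfolding S_def by (intro borel_measurable_sum measurable_letter_fun)
  define E where "E = (\<lambda>(s, q). {x \<in> space (Xmeas P). S s q x \<le> - h})"
  \<comment> \<open>Windows running past time \<open>n\<close> are included to keep the index set a
    product. Length 0 is excluded for Hoeffding; the lower bound is trivial there.\<close>
  define N1 where "N1 = (\<Union>sq\<in>{..n} \<times> {1..n}. E sq)"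
  define N2 where "N2 = {x \<in> space (Xmeas P). \<bar>S 0 n x - real n * m\<bar> \<ge> real n * \<theta> / 4}"
  have E: "E sq \<in> events" for sq
    using Smeas unfolding E_def by (cases sq) (auto intro!: borel_measurable_le)
  have N1: "N1 \<in> events" unfolding N1_def using E by (intro sets.finite_UN) auto
  have N2: "N2 \<in> events" using Smeas[of 0 n] unfolding N2_def by measurable
  have pE: "prob (E sq) \<le> exp (- (2 * \<mu> / (ln R)\<^sup>2 * h))" if mem: "sq \<in> {..n} \<times> {1..n}" for sq
  proof -
    obtain s q where sq: "sq = (s, q)" "0 < q" using mem by (cases sq) auto
    have "prob (E sq) \<le> exp (- (real q * m + h)\<^sup>2 / (2 * real q * (ln R)\<^sup>2))"
      using Hoeffding_letters(1)[where f = f and t = "real q * m + h" and q = q and s = s, OF supp f C]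
        sq mu(1) m h unfolding E_def S_def m_def by simp
    also have "\<dots> \<le> exp (- (2 * \<mu> / (ln R)\<^sup>2 * h))"
    proof -
      \<comment> \<open>The arithmetic-geometric mean inequality removes \<open>q\<close> from the
        exponent: short windows need a large relative deviation, long ones are held up by the drift.
        A union bound then suffices.\<close>
      have "4 * (real q * m) * h \<le> (real q * m + h)\<^sup>2"
        using sum_squares_bound[of "real q * m" h] by (simp add: power2_sum mult_ac)
      moreover have "4 * (real q * \<mu>) * h \<le> 4 * (real q * m) * h"
        using m h by (intro mult_right_mono mult_left_mono) auto
      ultimately have "4 * (real q * \<mu>) * h / (2 * real q * (ln R)\<^sup>2) \<le> (real q * m + h)\<^sup>2 / (2 * real q * (ln R)\<^sup>2)"
        by (intro divide_right_mono) auto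
      moreover have "4 * (real q * \<mu>) * h / (2 * real q * (ln R)\<^sup>2) = 2 * \<mu> / (ln R)\<^sup>2 * h"
        using sq(2) C by (simp add: field_simps)
      ultimately show ?thesis by simp
    qed
    finally show ?thesis .
  qed
  have "prob N1 \<le> (\<Sum>sq\<in>{..n} \<times> {1..n}. prob (E sq))"
    unfolding N1_def using E by (intro finite_measure_subadditive_finite) auto
  also have "\<dots> \<le> (\<Sum>sq\<in>{..n} \<times> {1..n}. exp (- (2 * \<mu> / (ln R)\<^sup>2 * h)))"
    by (intro sum_mono pE)
  also have "\<dots> = (real n + 1) * real n * exp (- (2 * \<mu> / (ln R)\<^sup>2 * h))" by (simp add: card_cartesian_product algebra_simps)
  also have "\<dots> \<le> (real n + 1)\<^sup>2 * exp (- (2 * \<mu> / (ln R)\<^sup>2 * h))"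
    by (intro mult_right_mono) (auto simp: power2_eq_square)
  finally have p1: "prob N1 \<le> (real n + 1)\<^sup>2 * exp (- (2 * \<mu> / (ln R)\<^sup>2 * h))" .
  have "prob N2 \<le> 2 * exp (- (real n * \<theta> / 4)\<^sup>2 / (2 * real n * (ln R)\<^sup>2))"
    using Hoeffding_letters(2)[where f = f and t = "real n * \<theta> / 4" and q = n and s = 0, OF supp f C]
      n theta unfolding N2_def S_def m_def by simp
  also have "- (real n * \<theta> / 4)\<^sup>2 / (2 * real n * (ln R)\<^sup>2) = - (real n * \<theta>\<^sup>2 / (32 * (ln R)\<^sup>2))"
    using n by (simp add: power2_eq_square)
  finally have p2: "prob N2 \<le> 2 * exp (- (real n * \<theta>\<^sup>2 / (32 * (ln R)\<^sup>2)))" .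
  define N where "N = N1 \<union> N2"
  have N: "N \<in> events" unfolding N_def using N1 N2 by auto
  have pN: "prob N \<le> \<pi>"
    unfolding N_def using measure_Un_le[OF N1 N2] p1 p2 prob by linarith
  have "\<kappa> \<le> 1" using kap cross2_le[of u v] fr unfolding eigenframe_def by auto
  \<comment> \<open>Lets the single error \<open>ln (4 / \<kappa>)\<close> also cover the factor 1/2
    in the lower bound.\<close>
  then have lK: "ln 2 \<le> ln (4 / \<kappa>)" using kap by (subst ln_le_cancel_iff) (auto simp: field_simps)
  define Y where "Y = (\<lambda>x. ln (mnorm (itr B x n)) / real n)"
  have good: "AE x in Xmeas P. x \<notin> N \<longrightarrow> \<bar>Y x - m\<bar> \<le> 3 * \<theta> / 8"
    using AE_letters[OF supp] AE_space
  proof eventually_elim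
    case (elim x)
    then have x: "\<And>i. x i \<in> {1..k}" by blast
    show ?case
    proof
      assume "x \<notin> N"
      then have dev: "\<bar>S 0 n x - real n * m\<bar> \<le> real n * \<theta> / 4"
        and out: "\<And>sq. sq \<in> {..n} \<times> {1..n} \<Longrightarrow> x \<notin> E sq"
        using elim unfolding N_def N2_def N1_def by auto
      have "- h \<le> S s q x" if "s + q \<le> n" for s q
      proof (cases "q = 0")
        case True
        then show ?thesis using h by (simp add: S_def)
      next
        case False
        then show ?thesis using out[of "(s, q)"] that elim unfolding E_def by simp
      qed
      then have drop: "- h \<le> (\<Sum>t<q. ln \<bar>a (x (int (t + s)))\<bar>)" if "s + q \<le> n" for s q
        using that unfolding S_def f_def by blast
      have lnR: "\<bar>ln \<bar>a j\<bar>\<bar> \<le> ln R" if "j \<in> {1..k}" for j using f[OF that] by (simp add: f_def)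
      have R0: "0 < R" using R(3) by simp
      have S0: "S 0 n x = (\<Sum>t<n. ln \<bar>a (x (int t))\<bar>)" by (simp add: S_def f_def)
      have "exp (S 0 n x) / 2 \<le> mnorm (itr B x n)" "mnorm (itr B x n) \<le> 4 / \<kappa> * exp (S 0 n x + 2 * h)"
        unfolding S0
        using mnorm_itr_shadowing[where x = x and B = B and \<epsilon> = \<epsilon> and R = R and h = h and n = n,
            OF fr x kap lnR R0 eps h drop small] by blast+
      moreover have "0 < mnorm (itr B x n)" using mnorm_itr_ge_1[where x = x and n = n, OF B x] by linarith
      ultimately have "ln (exp (S 0 n x) / 2) \<le> ln (mnorm (itr B x n))"
          "ln (mnorm (itr B x n)) \<le> ln (4 / \<kappa> * exp (S 0 n x + 2 * h))"
        using kap by (subst ln_le_cancel_iff; simp)+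
      moreover have "ln (4 / \<kappa> * exp (S 0 n x + 2 * h)) = ln (4 / \<kappa>) + (S 0 n x + 2 * h)"
        using kap by (subst ln_mult) auto
      moreover have "ln (exp (S 0 n x) / 2) = S 0 n x - ln 2" by (subst ln_div) auto
      ultimately have "\<bar>ln (mnorm (itr B x n)) - S 0 n x\<bar> \<le> 2 * h + ln (4 / \<kappa>)"
        using lK h by (auto simp: abs_le_iff)
      with dev have "\<bar>ln (mnorm (itr B x n)) - real n * m\<bar> \<le> (2 * h + ln (4 / \<kappa>)) + real n * \<theta> / 4" by linarith
      from abs_average_le[OF n this]
      have "\<bar>Y x - m\<bar> \<le> (2 * h + ln (4 / \<kappa>)) / real n + \<theta> / 4"
        using n by (simp add: Y_def add_divide_distrib)
      then show "\<bar>Y x - m\<bar> \<le> 3 * \<theta> / 8" using err by linarith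
    qed
  qed
  have "\<bar>Ln P B n - m\<bar> \<le> 3 * \<theta> / 8 + 2 * ln R * prob N"
    unfolding Ln_def
  proof (rule expectation_close)
    show "(\<lambda>x. ln (mnorm (itr B x n)) / real n) \<in> borel_measurable (Xmeas P)" by (rule measurable_itr)
    show "AE x in Xmeas P. x \<notin> N \<longrightarrow> \<bar>ln (mnorm (itr B x n)) / real n - m\<bar> \<le> 3 * \<theta> / 8"
      using good unfolding Y_def .
    show "AE x in Xmeas P. \<bar>ln (mnorm (itr B x n)) / real n - m\<bar> \<le> 2 * ln R"
      using AE_letters[OF supp]
    proof eventually_elim
      case (elim x)
      then have x: "\<And>i. x i \<in> {1..k}" by blast
      from ln_mnorm_itr_bounds[where x = x and n = n, OF B x R(1,3)] mC C show ?case
        by (auto simp: abs_le_iff)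
    qed
  qed (use N theta C in auto)
  also have "\<dots> \<le> 3 * \<theta> / 8 + 2 * ln R * \<pi>"
    using pN C by (intro add_left_mono mult_left_mono) auto
  finally have L: "\<bar>Ln P B n - m\<bar> \<le> \<theta> / 2" using pi by linarith
  have "prob {x \<in> space (Xmeas P). \<bar>ln (mnorm (itr B x n)) / real n - Ln P B n\<bar> > \<theta>} \<le> prob N"
  proof (rule finite_measure_mono_AE)
    show "AE x in Xmeas P. x \<in> {x \<in> space (Xmeas P). \<bar>ln (mnorm (itr B x n)) / real n - Ln P B n\<bar> > \<theta>} \<longrightarrow> x \<in> N"
      using good
    proof eventually_elim
      case (elim x)
      show ?case
      proof (intro impI, rule ccontr)
        assume "x \<in> {x \<in> space (Xmeas P). \<bar>ln (mnorm (itr B x n)) / real n - Ln P B n\<bar> > \<theta>}" "x \<notin> N"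
        then have "\<bar>Y x - Ln P B n\<bar> > \<theta>" "\<bar>Y x - m\<bar> \<le> 3 * \<theta> / 8" using elim by (auto simp: Y_def)
        then show False using L theta by linarith
      qed
    qed
  qed (rule N)
  then show ?thesis using pN by linarith
qed

section \<open>Distance to the diagonal cocycles and admissible scales\<close>

lemma mnorm_diff_le_dist_coc: "j \<in> {1..k} \<Longrightarrow> mnorm (A j - B j) \<le> dist_coc k A B"
  unfolding dist_coc_def by (intro Max_ge) auto

lemma dist_coc_nonneg: "1 \<le> k \<Longrightarrow> 0 \<le> dist_coc k A B"
  using mnorm_diff_le_dist_coc[of 1 k A B] mnorm_nonneg[of "A 1 - B 1"] by simp

lemma dist_Diag_bounds:
  assumes "Diag k A" "1 \<le> k"
  shows "0 \<le> dist_Diag k B" "dist_Diag k B \<le> dist_coc k B A"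
proof -
  show "0 \<le> dist_Diag k B"
    unfolding dist_Diag_def using assms dist_coc_nonneg by (intro cInf_greatest) auto
  have "bdd_below (dist_coc k B ` {D. Diag k D})"
    using dist_coc_nonneg[OF assms(2)] by (intro bdd_belowI[of _ 0]) auto
  then show "dist_Diag k B \<le> dist_coc k B A"
    unfolding dist_Diag_def using assms by (intro cInf_lower) auto
qed

lemma dist_Diag_lessD:
  assumes "Diag k A" "dist_Diag k B < e"
  obtains D where "Diag k D" "dist_coc k B D < e"
  using cInf_lessD[of "dist_coc k B ` {D. Diag k D}" e] assms unfolding dist_Diag_def by blast

text \<open>Solves the scale restriction for the distance. As \<open>d < 1\<close> the logarithm is
  positive and the \<open>p\<close>-th root may be taken; \<open>d = 0\<close> is the case of an
  infinite upper bound.\<close>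

lemma le_ln_inverse_power_imp_le_exp:
  fixes d :: real
  assumes "0 \<le> d" "d < 1" "1 \<le> p" "d = 0 \<or> real n \<le> ln (1 / d) ^ p"
  shows "d \<le> exp (- (real n powr (1 / real p)))"
proof (cases "d = 0")
  case False
  then have d: "0 < d" using assms(1) by simp
  then have l: "0 < ln (1 / d)" using assms(2) by simp
  have "real n powr (1 / real p) \<le> (ln (1 / d) ^ p) powr (1 / real p)"
    using assms False by (intro powr_mono2) auto
  also have "\<dots> = ln (1 / d)" using l assms(3) by (simp add: powr_powr flip: powr_realpow)
  finally have "exp (- ln (1 / d)) \<le> exp (- (real n powr (1 / real p)))" by simp
  then show ?thesis using d by (simp add: ln_div)
qed simp

text \<open>With \<open>h\<close> equal to \<open>n powr (r / 2)\<close>, \<open>exp (4 * h)\<close>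
  is beaten by \<open>exp (- (n powr r))\<close>, and \<open>h / n\<close> by
  \<open>n powr (- 1 / 5)\<close> because \<open>r / 2\<close> is below 4/5. Both probability terms
  beat the target: their exponents are of order \<open>n powr (r / 2)\<close> and
  \<open>n powr (3 / 5)\<close>, against \<open>n powr (r / 20)\<close>.\<close>

lemma eventually_scales_admissible:
  fixes \<delta> r K R C \<mu> l :: real
  assumes "0 < \<delta>" "0 < r" "r \<le> 1" "0 < K" "0 < R" "0 < C" "0 < \<mu>"
  shows "\<forall>\<^sub>F n :: nat in sequentially. 0 < n \<and> 2 * exp (- (real n powr r)) \<le> \<delta> \<and>
    4 * real n * K * R * (2 * exp (- (real n powr r))) * exp (4 * real n powr (r / 2)) \<le> 1 \<and>
    (2 * real n powr (r / 2) + l) / real n \<le> real n powr (- 1 / 5) / 8 \<and>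
    (real n + 1)\<^sup>2 * exp (- (2 * \<mu> / C\<^sup>2 * real n powr (r / 2)))
      + 2 * exp (- (real n * (real n powr (- 1 / 5))\<^sup>2 / (32 * C\<^sup>2))) \<le> exp (- (real n powr (r / 20))) \<and>
    2 * C * exp (- (real n powr (r / 20))) \<le> real n powr (- 1 / 5) / 8"
proof -
  have e1: "\<forall>\<^sub>F n :: nat in sequentially. 2 * exp (- (real n powr r)) \<le> \<delta>"
    using assms by real_asymp
  have "\<forall>\<^sub>F n :: nat in sequentially.
      c * real n * (2 * exp (- (real n powr r))) * exp (4 * real n powr (r / 2)) \<le> 1" if "0 < c" for c :: real
    using assms(2) that by real_asymp
  from this[of "4 * K * R"] have e2: "\<forall>\<^sub>F n :: nat in sequentially.
      4 * real n * K * R * (2 * exp (- (real n powr r))) * exp (4 * real n powr (r / 2)) \<le> 1"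
    using assms by (simp add: mult_ac)
  have e3: "\<forall>\<^sub>F n :: nat in sequentially. (2 * real n powr (r / 2) + l) / real n \<le> real n powr (- 1 / 5) / 8"
    using assms(2,3) by real_asymp
  have "\<forall>\<^sub>F n :: nat in sequentially.
      (real n + 1)\<^sup>2 * exp (- (c * real n powr (r / 2))) \<le> exp (- (real n powr (r / 20))) / 2" if "0 < c" for c :: real
    using assms(2) that by real_asymp
  from this[of "2 * \<mu> / C\<^sup>2"] have e4: "\<forall>\<^sub>F n :: nat in sequentially.
      (real n + 1)\<^sup>2 * exp (- (2 * \<mu> / C\<^sup>2 * real n powr (r / 2))) \<le> exp (- (real n powr (r / 20))) / 2"
    using assms by simp
  have "\<forall>\<^sub>F n :: nat in sequentially.
      2 * exp (- (real n * (real n powr (- 1 / 5))\<^sup>2 / c)) \<le> exp (- (real n powr (r / 20))) / 2" if "0 < c" for c :: real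
    using assms(2,3) that by real_asymp
  from this[of "32 * C\<^sup>2"] have e5: "\<forall>\<^sub>F n :: nat in sequentially.
      2 * exp (- (real n * (real n powr (- 1 / 5))\<^sup>2 / (32 * C\<^sup>2))) \<le> exp (- (real n powr (r / 20))) / 2"
    using assms by simp
  have "\<forall>\<^sub>F n :: nat in sequentially.
      c * exp (- (real n powr (r / 20))) \<le> real n powr (- 1 / 5) / 8" if "0 < c" for c :: real
    using assms(2) that by real_asymp
  from this[of "2 * C"] have e6: "\<forall>\<^sub>F n :: nat in sequentially.
      2 * C * exp (- (real n powr (r / 20))) \<le> real n powr (- 1 / 5) / 8"
    using assms by simp
  show ?thesis
    using eventually_gt_at_top[of "0 :: nat"] e1 e2 e3 e4 e5 e6 by eventually_elim linarith
qed

theorem theorem6p3: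
  fixes k :: nat and P :: "nat pmf" and A :: "nat \<Rightarrow> mat2" and p :: nat
  assumes "set_pmf P = {1..k}"
    and "Diag k A"
    and "Lyap P A > 0"
    and "p \<ge> 1"
  shows "\<exists>\<delta>>0. \<exists>nbar::nat. \<forall>B. SL2_cocycle k B \<and> dist_coc k B A \<le> \<delta> \<longrightarrow>
           (\<forall>n::nat. nbar \<le> n \<and>
              (dist_Diag k B = 0 \<or> real n \<le> (ln (1 / dist_Diag k B)) ^ p) \<longrightarrow>
              measure (Xmeas P)
                {x \<in> space (Xmeas P). \<bar>ln (mnorm (itr B x n)) / real n - Ln P B n\<bar> > real n powr (-1/5)}
              \<le> exp (- (real n powr (1 / (20 * real p)))))"
proof -
  note supp = assms(1) and A = assms(2)
  \<comment> \<open>A probability has nonempty support, so the maximum in \<open>dist_coc\<close> is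
    over a nonempty set.\<close>
  have k: "1 \<le> k" using supp set_pmf_not_empty[of P] by (cases "k = 0") auto
  obtain \<delta>0 \<kappa> \<mu> R :: real where pos: "0 < \<delta>0" "0 < \<kappa>" "0 < \<mu>" "1 < R"
    and BR: "\<And>B j. j \<in> {1..k} \<Longrightarrow> mnorm (B j - A j) \<le> \<delta>0 \<Longrightarrow> mnorm (B j) \<le> R"
    and frames: "\<And>D. Diag k D \<Longrightarrow> \<forall>j\<in>{1..k}. mnorm (D j - A j) \<le> \<delta>0 \<Longrightarrow>
      \<exists>u v a b. eigenframe k D u v a b \<and> \<kappa> \<le> \<bar>cross2 u v\<bar> \<and>
        \<mu> \<le> measure_pmf.expectation P (\<lambda>j. ln \<bar>a j\<bar>)"
    using uniform_eigenframes[OF assms(1-3)] by metis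
  \<comment> \<open>The bound 1/2 makes the distance to the diagonal cocycles less than 1. Half of
    \<open>\<delta>0\<close> suffices because \<open>D\<close> is within \<open>\<delta>\<close> of
    \<open>B\<close> and \<open>B\<close> within \<open>\<delta>\<close> of
    \<open>A\<close>.\<close>
  define \<delta> where "\<delta> = min (1 / 2) (\<delta>0 / 2)"
  have del: "0 < \<delta>" "\<delta> < 1" "\<delta> \<le> \<delta>0 / 2" using pos by (auto simp: \<delta>_def)
  define r where "r = 1 / real p"
  have r: "0 < r" "r \<le> 1" using assms(4) by (auto simp: r_def)
  have r20: "1 / (20 * real p) = r / 20" by (simp add: r_def)
  obtain nbar where nbar: "\<And>n. nbar \<le> n \<Longrightarrow> 0 < n \<and> 2 * exp (- (real n powr r)) \<le> \<delta> \<and>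
    4 * real n * (2 / \<kappa>)\<^sup>2 * R * (2 * exp (- (real n powr r))) * exp (4 * real n powr (r / 2)) \<le> 1 \<and>
    (2 * real n powr (r / 2) + ln (4 / \<kappa>)) / real n \<le> real n powr (- 1 / 5) / 8 \<and>
    (real n + 1)\<^sup>2 * exp (- (2 * \<mu> / (ln R)\<^sup>2 * real n powr (r / 2)))
      + 2 * exp (- (real n * (real n powr (- 1 / 5))\<^sup>2 / (32 * (ln R)\<^sup>2))) \<le> exp (- (real n powr (r / 20))) \<and>
    2 * ln R * exp (- (real n powr (r / 20))) \<le> real n powr (- 1 / 5) / 8"
    using eventually_scales_admissible[of \<delta> r "(2 / \<kappa>)\<^sup>2" R "ln R" \<mu> "ln (4 / \<kappa>)"] del r pos
    unfolding eventually_sequentially by auto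
  have main: "measure (Xmeas P)
        {x \<in> space (Xmeas P). \<bar>ln (mnorm (itr B x n)) / real n - Ln P B n\<bar> > real n powr (-1/5)}
      \<le> exp (- (real n powr (1 / (20 * real p))))"
    if B: "SL2_cocycle k B" and BA: "dist_coc k B A \<le> \<delta>" and n: "nbar \<le> n"
      and scale: "dist_Diag k B = 0 \<or> real n \<le> (ln (1 / dist_Diag k B)) ^ p" for B n
  proof -
    note nb = nbar[OF n]
    have "dist_Diag k B \<le> exp (- (real n powr r))"
      unfolding r_def using dist_Diag_bounds[OF A k, of B] BA del scale assms(4)
      by (intro le_ln_inverse_power_imp_le_exp) auto
    \<comment> \<open>The infimum need not be attained; the factor 2 supplies the strict inequality
      that yields an actual \<open>D\<close>.\<close>
    then have "dist_Diag k B < 2 * exp (- (real n powr r))"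
      using exp_gt_zero[of "- (real n powr r)"] by linarith
    then obtain D where D: "Diag k D" "dist_coc k B D < 2 * exp (- (real n powr r))"
      by (rule dist_Diag_lessD[OF A])
    have BD: "mnorm (B j - D j) \<le> 2 * exp (- (real n powr r))" if "j \<in> {1..k}" for j
      using mnorm_diff_le_dist_coc[OF that, of B D] D(2) by linarith
    have BA': "mnorm (B j - A j) \<le> \<delta>" if "j \<in> {1..k}" for j
      using mnorm_diff_le_dist_coc[OF that, of B A] BA by linarith
    have DA: "mnorm (D j - A j) \<le> \<delta>0" if "j \<in> {1..k}" for j
      using mnorm_triangle[of "D j - B j" "B j - A j"] mnorm_minus_commute[of "D j" "B j"]
        BD[OF that] BA'[OF that] nb del(3) by simp
    obtain u v a b where fr: "eigenframe k D u v a b" "\<kappa> \<le> \<bar>cross2 u v\<bar>"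
        "\<mu> \<le> measure_pmf.expectation P (\<lambda>j. ln \<bar>a j\<bar>)"
      using frames[OF D(1)] DA by blast
    have R: "mnorm (B j) \<le> R" "mnorm (D j) \<le> R" if "j \<in> {1..k}" for j
      using BR[where B = B, OF that] BR[where B = D, OF that] BA'[OF that] DA[OF that] del by auto
    show ?thesis
      unfolding r20
      by (rule deviation_bound[where h = "real n powr (r / 2)" and \<epsilon> = "2 * exp (- (real n powr r))",
            OF supp B fr(1) pos(2) fr(2) R pos(4) pos(3) fr(3) BD])
        (use nb in auto)
  qed
  show ?thesis
    by (rule exI[of _ \<delta>], rule conjI[OF del(1)], rule exI[of _ nbar]) (use main in blast)
qed

end
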